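(* The Brownian drift experiment $\mathcal{E}_{\mathrm{drift}}=(C[0,1],\mathcal{B},\{\mathrm{P}_{\theta}\mid\theta\in D[0,1]\})$ is boundedly complete.
   Context: $C[0,1]$ is the set of real-valued continuous functions on $[0,1]$, endowed with the $\sigma$-field $\mathcal{B}$ generated by the topology of uniform convergence. $D[0,1]$ is the set of real-valued c\`adl\`ag functions on $[0,1]$. For $\theta\in D[0,1]$, $\mathrm{P}_{\theta}$ is the probability measure on $(C[0,1],\mathcal{B})$ that is the law of the process $X$ defined by $X(0)=0$ and $dX(u)=\theta(u)\,du+dW(u)$, $u\in[0,1]$, where $W$ is a standard Brownian motion; that is, $X(u)=\int_0^u\theta(v)\,dv+W(u)$. $\mathrm{E}_{\theta}$ denotes expectation under $\mathrm{P}_{\theta}$. A real random variable $Y$ is (essentially) bounded if there is a constant $0\le M<\infty$ with $\mathrm{P}_{\theta}(|Y|\le M)=1$ for all $\theta$ in the parameter space. An experiment with $\sigma$-field $\mathcal{B}$ and family $\{\mathrm{P}_{\theta}\}$ is boundedly complete if every $\mathcal{B}$-measurable (essentially) bounded real random variable $Y$ such that $\mathrm{E}_{\theta}(Y)=0$ for all $\theta$ is $\mathrm{P}_{\theta}$-a.s. equal to zero for all $\theta$. *)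

theory Defs
  imports "HOL-Probability.Probability"
begin

text \<open>
  \<open>C[0,1]\<close> is carried by the library's sup-metric space of continuous functions on the
  compact space \<open>[0,1]\<close>. Its elements are \<^const>\<open>extensional\<close> functions on the real line, so
  that they are determined by their values on \<open>[0,1]\<close>; boundedness, which
  \<^const>\<open>cfunspace\<close> asks for, is automatic there.
\<close>

definition C01_metric :: "(real \<Rightarrow> real) metric" where
  "C01_metric = cfunspace (top_of_set {0..1}) euclidean_metric"

definition C01 :: "(real \<Rightarrow> real) measure" where
  "C01 = sigma (mspace C01_metric) {U. openin (mtopology_of C01_metric) U}"

lemma mspace_C01_metric:
  "mspace C01_metric = {f \<in> extensional {0..1}. continuous_on {0..1} f}"
  by (auto simp: C01_metric_def compact_continuous_image compact_imp_bounded)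

lemma space_C01: "space C01 = {f \<in> extensional {0..1}. continuous_on {0..1} f}"
  unfolding C01_def mspace_C01_metric [symmetric] by (rule space_measure_of_conv)

lemma sets_C01:
  "sets C01 = sigma_sets (mspace C01_metric) {U. openin (mtopology_of C01_metric) U}"
  unfolding C01_def
  by (rule sets_measure_of) (auto dest!: openin_subset)

definition D01 :: "(real \<Rightarrow> real) set" where
  "D01 = {\<theta> \<in> extensional {0..1}.
            (\<forall>t\<in>{0..<1}. (\<theta> \<longlongrightarrow> \<theta> t) (at_right t)) \<and>
            (\<forall>t\<in>{0<..1}. \<exists>l. (\<theta> \<longlongrightarrow> l) (at_left t))}"

locale standard_brownian_motion = prob_space M for M :: "'a measure" +
  fixes W :: "real \<Rightarrow> 'a \<Rightarrow> real"
  assumes random_variable: "t \<in> {0..1} \<Longrightarrow> W t \<in> borel_measurable M"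
    and start: "\<omega> \<in> space M \<Longrightarrow> W 0 \<omega> = 0"
    and continuous_paths: "\<omega> \<in> space M \<Longrightarrow> continuous_on {0..1} (\<lambda>t. W t \<omega>)"
    and gaussian_increments: "0 \<le> s \<Longrightarrow> s < t \<Longrightarrow> t \<le> 1 \<Longrightarrow>
          distributed M lborel (\<lambda>\<omega>. W t \<omega> - W s \<omega>) (normal_density 0 (sqrt (t - s)))"
    and independent_increments: "strict_mono_on {..n} \<tau> \<Longrightarrow> \<tau> ` {..n} \<subseteq> {0..1} \<Longrightarrow>
          indep_vars (\<lambda>_. borel) (\<lambda>i \<omega>. W (\<tau> (Suc i)) \<omega> - W (\<tau> i) \<omega>) {..<n :: nat}"

text \<open>The path of \<open>dX(u) = \<theta>(u) du + dW(u)\<close>, \<open>X(0) = 0\<close>, as an element of \<open>C[0,1]\<close>.\<close>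

definition drift_path :: "(real \<Rightarrow> 'a \<Rightarrow> real) \<Rightarrow> (real \<Rightarrow> real) \<Rightarrow> 'a \<Rightarrow> real \<Rightarrow> real" where
  "drift_path W \<theta> \<omega> = (\<lambda>u\<in>{0..1}. (LINT v:{0..u}|lborel. \<theta> v) + W u \<omega>)"

definition drift_law ::
    "'a measure \<Rightarrow> (real \<Rightarrow> 'a \<Rightarrow> real) \<Rightarrow> (real \<Rightarrow> real) \<Rightarrow> (real \<Rightarrow> real) measure" where
  "drift_law M W \<theta> = distr M C01 (drift_path W \<theta>)"

text \<open>
  In the experiment given by \<open>B\<close>, \<open>\<Theta>\<close> and \<open>P\<close>, only the space and the \<open>\<sigma>\<close>-field of \<open>B\<close>
  matter; \<open>P \<theta>\<close>, for \<open>\<theta> \<in> \<Theta>\<close>, is meant to be a probability measure on that \<open>\<sigma>\<close>-field.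
\<close>

definition essentially_bounded ::
    "'x measure \<Rightarrow> 'p set \<Rightarrow> ('p \<Rightarrow> 'x measure) \<Rightarrow> ('x \<Rightarrow> real) \<Rightarrow> bool" where
  "essentially_bounded B \<Theta> P Y \<longleftrightarrow>
     (\<exists>K\<ge>0. \<forall>\<theta>\<in>\<Theta>. measure (P \<theta>) {x \<in> space B. \<bar>Y x\<bar> \<le> K} = 1)"

definition boundedly_complete ::
    "'x measure \<Rightarrow> 'p set \<Rightarrow> ('p \<Rightarrow> 'x measure) \<Rightarrow> bool" where
  "boundedly_complete B \<Theta> P \<longleftrightarrow>
     (\<forall>Y \<in> borel_measurable B.
        essentially_bounded B \<Theta> P Y \<longrightarrow>
        (\<forall>\<theta>\<in>\<Theta>. (LINT x|P \<theta>. Y x) = 0) \<longrightarrow>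
        (\<forall>\<theta>\<in>\<Theta>. AE x in P \<theta>. Y x = 0))"

end

theory Submission
  imports Defs
begin

text \<open>
  Fix \<open>\<theta>\<close> and perturb it by step functions \<open>h\<close> that are constant on the dyadic intervals of
  level \<open>n\<close>. The law under \<open>\<theta> + h\<close> has, with respect to the law under \<open>\<theta>\<close>, the density
  \<open>exp (\<Sum>j. c j * \<Delta>W j - (c j)\<^sup>2 / 2 ^ n / 2)\<close>, where \<open>c j\<close> are the values of \<open>h\<close>. So if \<open>Y\<close> has mean
  zero under all \<open>\<theta> + h\<close>, then \<open>Y\<close> times any exponential of a linear combination of the level-\<open>n\<close>
  increments has mean zero under \<open>\<theta>\<close>, and uniqueness of the Laplace transform makes \<open>Y\<close>
  orthogonal to everything that depends on finitely many dyadic increments. These generate the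
  \<open>\<sigma>\<close>-field of \<open>C[0,1]\<close>, so \<open>Y = 0\<close> almost surely under \<open>\<theta>\<close>. Perturbing around \<open>\<theta>\<close> instead of
  \<open>0\<close> makes Girsanov's theorem for general drifts unnecessary.
\<close>

section \<open>Dyadic cylinders generate the Borel sets of \<open>C[0,1]\<close>\<close>

definition dyadic_grid :: "nat \<Rightarrow> real set" where
  "dyadic_grid m = (\<lambda>j::nat. real j / 2 ^ m) ` {..2 ^ m}"

definition dyadic_points :: "real set" where
  "dyadic_points = (\<Union>m. dyadic_grid m)"

lemma dyadic_points_subset: "dyadic_points \<subseteq> {0..1}"
  by (auto simp: dyadic_points_def dyadic_grid_def divide_le_eq)

lemma countable_dyadic_points: "countable dyadic_points"
  by (auto simp: dyadic_points_def dyadic_grid_def)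

lemma closure_dyadic_points: "closure dyadic_points = {0..1}"
proof
  show "closure dyadic_points \<subseteq> {0..1}"
    by (intro closure_minimal dyadic_points_subset) simp
  show "{0..1} \<subseteq> closure dyadic_points"
  proof
    fix x :: real assume x: "x \<in> {0..1}"
    show "x \<in> closure dyadic_points" unfolding closure_approachable
    proof (intro allI impI)
      fix e :: real assume "0 < e"
      then obtain m where m: "(1 / 2) ^ m < e"
        using real_arch_pow_inv[of e "1/2"] by auto
      define j where "j = nat \<lfloor>x * 2 ^ m\<rfloor>"
      have j: "real j \<le> x * 2 ^ m" "x * 2 ^ m < real j + 1"
        using x by (auto simp: j_def)
      have "x * 2 ^ m \<le> 2 ^ m" using x by simp
      then have "real j \<le> 2 ^ m" using j(1) by linarith
      then have "j \<le> 2 ^ m" by simp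
      then have "real j / 2 ^ m \<in> dyadic_points" by (auto simp: dyadic_points_def dyadic_grid_def)
      moreover have "\<bar>real j / 2 ^ m - x\<bar> \<le> (1 / 2) ^ m"
      proof -
        have "real j / 2 ^ m \<le> x" "x < (real j + 1) / 2 ^ m"
          using j by (simp_all add: pos_divide_le_eq pos_less_divide_eq)
        then show ?thesis
          by (simp add: abs_le_iff add_divide_distrib power_one_over)
      qed
      ultimately show "\<exists>y\<in>dyadic_points. dist y x < e"
        using m by (intro bexI[of _ "real j / 2 ^ m"]) (auto simp: dist_real_def)
    qed
  qed
qed

lemma dyadic_grid_mono:
  assumes "m \<le> m'"
  shows "dyadic_grid m \<subseteq> dyadic_grid m'"
proof
  fix t assume "t \<in> dyadic_grid m"
  then obtain j :: nat where t: "t = real j / 2 ^ m" and j: "j \<le> 2 ^ m"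
    unfolding dyadic_grid_def by blast
  obtain d where d: "m' = m + d" using assms le_Suc_ex by blast
  have "t = real (j * 2 ^ d) / 2 ^ m'"
    unfolding t d power_add of_nat_mult of_nat_power of_nat_numeral
    by (rule mult_divide_mult_cancel_right[symmetric]) simp
  moreover have "j * 2 ^ d \<in> {..2 ^ m'}"
    using j unfolding d power_add atMost_iff by (rule mult_le_mono1)
  ultimately show "t \<in> dyadic_grid m'"
    unfolding dyadic_grid_def by (rule image_eqI)
qed

text \<open>The grids are nested, so finitely many points fit on one of them. The lower bound
  \<open>n\<close> lets this grid be chosen at least as fine as the grid of a given step
  function.\<close>

lemma finite_subset_dyadic_points:
  assumes "finite T" "T \<subseteq> dyadic_points"
  shows "\<exists>m\<ge>n. T \<subseteq> dyadic_grid m"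
  using assms
proof (induction T rule: finite_induct)
  case empty
  then show ?case by blast
next
  case (insert t T)
  obtain m where m: "n \<le> m" "T \<subseteq> dyadic_grid m"
    using insert.IH insert.prems by blast
  obtain m' where m': "t \<in> dyadic_grid m'"
    using insert.prems unfolding dyadic_points_def by blast
  have "insert t T \<subseteq> dyadic_grid (max m m')"
    using m m' dyadic_grid_mono[of m "max m m'"] dyadic_grid_mono[of m' "max m m'"] by auto
  then show ?case using m by (intro exI[of _ "max m m'"]) auto
qed

section \<open>The uniform metric and evaluation at points\<close>

lemma abs_diff_le_mdist_C01:
  assumes "x \<in> mspace C01_metric" "y \<in> mspace C01_metric" "t \<in> {0..1}"
  shows "\<bar>x t - y t\<bar> \<le> mdist C01_metric x y"
  using mdist_cfunspace_imp_mdist_le[of x "top_of_set {0..1}" euclidean_metric y "mdist C01_metric x y" t] assms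
  by (simp add: C01_metric_def dist_real_def)

text \<open>Dyadic points are dense and paths are continuous, so a bound at dyadic times extends to
  all times. This reduces uniform distance to countably many coordinates.\<close>

lemma mdist_C01_le:
  assumes xy: "x \<in> mspace C01_metric" "y \<in> mspace C01_metric" and a: "0 \<le> a"
    and le: "\<And>t. t \<in> dyadic_points \<Longrightarrow> \<bar>x t - y t\<bar> \<le> a"
  shows "mdist C01_metric x y \<le> a"
proof -
  have "continuous_on (closure dyadic_points) (\<lambda>t. \<bar>x t - y t\<bar>)"
    using xy by (auto simp: closure_dyadic_points mspace_C01_metric intro!: continuous_intros)
  then have "\<bar>x t - y t\<bar> \<le> a" if "t \<in> {0..1}" for t
    using that continuous_le_on_closure[where S = dyadic_points] le closure_dyadic_points by blast
  then show ?thesis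
    using a by (auto simp: C01_metric_def dist_real_def intro!: mdist_cfunspace_le)
qed

interpretation C01: Metric_space "mspace C01_metric" "mdist C01_metric"
  by (rule Metric_space_mspace_mdist)

text \<open>Evaluation is 1-Lipschitz for the uniform metric, so preimages of open sets are
  open.\<close>

lemma measurable_eval_C01 [measurable]:
  assumes "t \<in> {0..1}"
  shows "(\<lambda>x. x t) \<in> borel_measurable C01"
proof (rule borel_measurableI)
  fix S :: "real set" assume "open S"
  have "openin C01.mtopology ((\<lambda>x. x t) -` S \<inter> space C01)"
    unfolding C01.openin_mtopology
  proof (intro conjI allI impI)
    show "(\<lambda>x. x t) -` S \<inter> space C01 \<subseteq> mspace C01_metric"
      by (auto simp: space_C01 mspace_C01_metric)
    fix x assume x: "x \<in> (\<lambda>x. x t) -` S \<inter> space C01"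
    then obtain r where r: "0 < r" "ball (x t) r \<subseteq> S"
      using openE[OF \<open>open S\<close>, of "x t"] by auto
    show "\<exists>r>0. C01.mball x r \<subseteq> (\<lambda>x. x t) -` S \<inter> space C01"
    proof (intro exI conjI)
      show "C01.mball x r \<subseteq> (\<lambda>x. x t) -` S \<inter> space C01"
      proof
        fix y assume "y \<in> C01.mball x r"
        then have y: "x \<in> mspace C01_metric" "y \<in> mspace C01_metric" "mdist C01_metric x y < r"
          by auto
        then have "dist (x t) (y t) < r"
          using abs_diff_le_mdist_C01[of x y t] assms by (simp add: dist_real_def)
        then show "y \<in> (\<lambda>x. x t) -` S \<inter> space C01"
          using r y by (auto simp: space_C01 mspace_C01_metric)
      qed
    qed (rule r)
  qed
  then show "(\<lambda>x. x t) -` S \<inter> space C01 \<in> sets C01"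
    unfolding sets_C01 mtopology_of_def by (intro sigma_sets.Basic) simp
qed

section \<open>A countable dense family: Bernstein polynomials with rational coefficients\<close>

definition rat_Bernstein :: "rat list \<Rightarrow> real \<Rightarrow> real" where
  "rat_Bernstein qs = (\<lambda>x\<in>{0..1}. \<Sum>k\<le>length qs - 1. real_of_rat (qs ! k) * Bernstein (length qs - 1) k x)"

lemma rat_Bernstein_in_C01: "rat_Bernstein qs \<in> mspace C01_metric"
  unfolding mspace_C01_metric rat_Bernstein_def Bernstein_def
  by (auto intro!: continuous_intros cong: continuous_on_cong_simp)

text \<open>The Bernstein-Weierstrass theorem costs \<open>e / 2\<close>. Rounding the coefficients
  to rationals costs at most another \<open>e / 2\<close>, because the Bernstein basis is
  nonnegative and sums to 1.\<close>

lemma rat_Bernstein_dense: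
  assumes x: "x \<in> mspace C01_metric" and "0 < e"
  shows "\<exists>qs. mdist C01_metric (rat_Bernstein qs) x \<le> e"
proof -
  have "continuous_on {0..1} x"
    using x by (auto simp: mspace_C01_metric)
  then obtain n where n: "\<And>t. t \<in> {0..1} \<Longrightarrow> \<bar>x t - (\<Sum>k\<le>n. x (k / n) * Bernstein n k t)\<bar> < e / 2"
    using Bernstein_Weierstrass[of x "e / 2"] \<open>0 < e\<close> by auto
  have "\<exists>q. \<bar>real_of_rat q - x (real k / n)\<bar> < e / 2" for k
  proof -
    obtain p where "x (real k / n) - e / 2 < real_of_rat p" "real_of_rat p < x (real k / n) + e / 2"
      using of_rat_dense[of "x (real k / n) - e / 2" "x (real k / n) + e / 2"] \<open>0 < e\<close> by auto
    then show ?thesis by (intro exI[of _ p]) (simp only: abs_less_iff, linarith)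
  qed
  then obtain q where q: "\<And>k. \<bar>real_of_rat (q k) - x (real k / n)\<bar> < e / 2"
    by metis
  define qs where "qs = map q [0..<Suc n]"
  have qs: "length qs - 1 = n" "\<And>k. k \<le> n \<Longrightarrow> qs ! k = q k"
    by (auto simp: qs_def nth_append simp del: upt_Suc)
  have "\<bar>rat_Bernstein qs t - x t\<bar> \<le> e" if "t \<in> dyadic_points" for t
  proof -
    have t: "t \<in> {0..1}" using that dyadic_points_subset by auto
    have "\<bar>rat_Bernstein qs t - (\<Sum>k\<le>n. x (k / n) * Bernstein n k t)\<bar>
        = \<bar>\<Sum>k\<le>n. (real_of_rat (q k) - x (k / n)) * Bernstein n k t\<bar>"
      using t qs by (simp add: rat_Bernstein_def sum_subtractf left_diff_distrib)
    also have "\<dots> \<le> (\<Sum>k\<le>n. e / 2 * Bernstein n k t)"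
    proof (intro sum_abs[THEN order_trans] sum_mono)
      fix k
      show "\<bar>(real_of_rat (q k) - x (k / n)) * Bernstein n k t\<bar> \<le> e / 2 * Bernstein n k t"
        using t Bernstein_nonneg[of t n k] mult_right_mono[OF less_imp_le[OF q[of k]]]
        by (auto simp: abs_mult simp del: times_divide_eq_left)
    qed
    also have "\<dots> = e / 2"
      by (simp only: sum_distrib_left [symmetric] sum_Bernstein mult_1_right)
    finally show ?thesis using n[OF t] by linarith
  qed
  then show ?thesis
    using mdist_C01_le[OF rat_Bernstein_in_C01 x less_imp_le[OF \<open>0 < e\<close>]] by blast
qed

section \<open>Cylinder sets over dyadic times\<close>

definition cylinder :: "real set \<Rightarrow> (real \<Rightarrow> real set) \<Rightarrow> (real \<Rightarrow> real) set" where
  "cylinder T A = {x \<in> space C01. \<forall>t\<in>T. x t \<in> A t}"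

definition cylinders :: "(real \<Rightarrow> real) set set" where
  "cylinders = {cylinder T A | T A. finite T \<and> T \<subseteq> dyadic_points \<and> range A \<subseteq> sets borel}"

lemma cylinder_sets:
  assumes "finite T" "T \<subseteq> dyadic_points" "range A \<subseteq> sets borel"
  shows "cylinder T A \<in> sets C01"
proof -
  have "{x \<in> space C01. x t \<in> A t} \<in> sets C01" if "t \<in> T" for t
  proof -
    have [measurable]: "(\<lambda>x. x t) \<in> borel_measurable C01" "A t \<in> sets borel"
      using that assms dyadic_points_subset by (auto intro!: measurable_eval_C01)
    show ?thesis by measurable
  qed
  then show ?thesis
    unfolding cylinder_def using assms by (intro sets.sets_Collect_finite_All) auto
qed

text \<open>Cylinders are Borel because evaluations are. Conversely, closed balls are countable
  intersections of cylinders, and by separability every open set is a countable union of closed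
  balls.\<close>

lemma sets_C01_cylinders: "sets C01 = sigma_sets (space C01) cylinders"
proof
  show "sigma_sets (space C01) cylinders \<subseteq> sets C01"
    by (intro sets.sigma_sets_subset) (auto simp: cylinders_def intro: cylinder_sets)
next
  let ?S = "sigma_sets (space C01) cylinders"
  have sp: "space C01 = mspace C01_metric"
    by (simp add: space_C01 mspace_C01_metric)
  have sub: "cylinders \<subseteq> Pow (space C01)"
    by (auto simp: cylinders_def cylinder_def)
  interpret S: sigma_algebra "space C01" ?S
    by (rule sigma_algebra_sigma_sets[OF sub])
  have cball: "C01.mcball c r \<in> ?S" if c: "c \<in> mspace C01_metric" and "0 \<le> r" for c r
  proof -
    \<comment> \<open>The closed ball is the set of paths within the band of half-width
      \<open>r\<close> around \<open>c\<close>, and it suffices to check the band at dyadic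
      times.\<close>
    let ?I = "\<lambda>t. cylinder {t} (\<lambda>t. {c t - r..c t + r})"
    have "C01.mcball c r = (\<Inter>t\<in>dyadic_points. ?I t)"
    proof (intro set_eqI iffI)
      fix y assume "y \<in> C01.mcball c r"
      then have y: "y \<in> mspace C01_metric" "mdist C01_metric c y \<le> r" by auto
      have "\<bar>c t - y t\<bar> \<le> r" if "t \<in> dyadic_points" for t
        using abs_diff_le_mdist_C01[OF c y(1), of t] y(2) that dyadic_points_subset by auto
      then show "y \<in> (\<Inter>t\<in>dyadic_points. ?I t)"
        using y(1) by (auto simp: cylinder_def sp abs_le_iff algebra_simps)
    next
      fix y assume y: "y \<in> (\<Inter>t\<in>dyadic_points. ?I t)"
      have "0 \<in> dyadic_points" by (auto simp: dyadic_points_def dyadic_grid_def image_iff)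
      then have "y \<in> mspace C01_metric" using y by (auto simp: cylinder_def sp)
      moreover have "mdist C01_metric c y \<le> r"
        using y by (intro mdist_C01_le[OF c \<open>y \<in> mspace C01_metric\<close> \<open>0 \<le> r\<close>]) (auto simp: cylinder_def abs_le_iff algebra_simps)
      ultimately show "y \<in> C01.mcball c r" using c by simp
    qed
    moreover have "?I t \<in> ?S" if "t \<in> dyadic_points" for t
    proof (intro sigma_sets.Basic)
      show "?I t \<in> cylinders"
        unfolding cylinders_def using that by (intro CollectI exI[of _ "{t}"] exI conjI) auto
    qed
    moreover have "dyadic_points \<noteq> {}" by (auto simp: dyadic_points_def dyadic_grid_def)
    ultimately show ?thesis
      using S.countable_INT'[OF countable_dyadic_points, of ?I] by (simp add: image_subset_iff)
  qed
  have "U \<in> ?S" if U: "openin C01.mtopology U" for U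
  proof -
    \<comment> \<open>Lists of rationals and naturals index countably many balls: centres from the
      dense family, radii tending to 0.\<close>
    let ?J = "{(qs, n). C01.mcball (rat_Bernstein qs) (1 / real (Suc n)) \<subseteq> U}"
    have "U = (\<Union>(qs, n)\<in>?J. C01.mcball (rat_Bernstein qs) (1 / real (Suc n)))"
    proof (intro equalityI subsetI)
      fix x assume "x \<in> U"
      then obtain r where r: "0 < r" "C01.mball x r \<subseteq> U" and x: "x \<in> mspace C01_metric"
        using U unfolding C01.openin_mtopology by blast
      \<comment> \<open>With radius below \<open>r / 2\<close>, a ball whose centre is within its
        radius of \<open>x\<close> contains \<open>x\<close> and stays within distance
        \<open>r\<close> of it.\<close>
      obtain n where n: "1 / real (Suc n) < r / 2"
        using nat_approx_posE[of "r / 2"] r by auto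
      obtain qs where qs: "mdist C01_metric (rat_Bernstein qs) x \<le> 1 / real (Suc n)"
        using rat_Bernstein_dense[OF x, of "1 / real (Suc n)"] by auto
      have "C01.mcball (rat_Bernstein qs) (1 / real (Suc n)) \<subseteq> C01.mball x r"
      proof
        fix y assume y: "y \<in> C01.mcball (rat_Bernstein qs) (1 / real (Suc n))"
        then have "mdist C01_metric x y \<le> mdist C01_metric (rat_Bernstein qs) x + mdist C01_metric (rat_Bernstein qs) y"
          using C01.triangle[of x "rat_Bernstein qs" y] x rat_Bernstein_in_C01 C01.commute by simp
        then show "y \<in> C01.mball x r" using y qs n x by simp
      qed
      then have "(qs, n) \<in> ?J" using r by auto
      moreover have "x \<in> C01.mcball (rat_Bernstein qs) (1 / real (Suc n))"
        using qs x rat_Bernstein_in_C01 by simp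
      ultimately show "x \<in> (\<Union>(qs, n)\<in>?J. C01.mcball (rat_Bernstein qs) (1 / real (Suc n)))"
        by blast
    qed auto
    moreover have "\<dots> \<in> ?S"
      by (intro S.countable_UN' countableI_type) (auto intro!: cball rat_Bernstein_in_C01)
    ultimately show ?thesis by simp
  qed
  then show "sets C01 \<subseteq> ?S"
    unfolding sets_C01 sp[symmetric] mtopology_of_def
    by (intro S.sigma_sets_subset) auto
qed

lemma Int_stable_cylinders: "Int_stable cylinders"
proof (rule Int_stableI)
  fix a b assume "a \<in> cylinders" "b \<in> cylinders"
  then obtain T A U B where ab: "a = cylinder T A" "finite T" "T \<subseteq> dyadic_points" "range A \<subseteq> sets borel"
      "b = cylinder U B" "finite U" "U \<subseteq> dyadic_points" "range B \<subseteq> sets borel"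
    unfolding cylinders_def by blast
  \<comment> \<open>Putting \<open>UNIV\<close> at unconstrained times places both cylinders over
    \<open>T \<union> U\<close>, where they intersect coordinatewise.\<close>
  let ?C = "\<lambda>t. (if t \<in> T then A t else UNIV) \<inter> (if t \<in> U then B t else UNIV)"
  have "a \<inter> b = cylinder (T \<union> U) ?C"
    by (auto simp: ab cylinder_def)
  moreover have "?C t \<in> sets borel" for t
    using ab by auto
  ultimately show "a \<inter> b \<in> cylinders"
    unfolding cylinders_def using ab by (intro CollectI exI[of _ "T \<union> U"] exI[of _ ?C]) auto
qed

lemma space_C01_in_cylinders: "space C01 \<in> cylinders"
  unfolding cylinders_def cylinder_def by (intro CollectI exI[of _ "{}"] exI[of _ "\<lambda>_. {}"]) auto

section \<open>Increments on a grid determine measures on path space\<close>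

fun increment :: "nat \<Rightarrow> (real \<Rightarrow> real) \<Rightarrow> nat \<Rightarrow> real" where
  "increment m x 0 = x 0"
| "increment m x (Suc j) = x (real (Suc j) / 2 ^ m) - x (real j / 2 ^ m)"

text \<open>Slot 0 of \<open>increment\<close> holds the starting value, so the partial sums
  telescope to path values and not merely to differences.\<close>

lemma sum_increment: "(\<Sum>i\<le>j. increment m x i) = x (real j / 2 ^ m)"
  by (induction j) auto

lemma measurable_increment [measurable]:
  assumes "j \<le> 2 ^ m"
  shows "(\<lambda>x. increment m x j) \<in> borel_measurable C01"
proof -
  have *: "real i / 2 ^ m \<in> {0..1}" if "i \<le> 2 ^ m" for i
    using that dyadic_points_subset by (auto simp: dyadic_points_def dyadic_grid_def)
  show ?thesis
  proof (cases j)
    case 0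
    then show ?thesis by (simp add: measurable_eval_C01)
  next
    case (Suc i)
    then show ?thesis
      using * [of j] *[of i] assms by (auto intro!: borel_measurable_diff measurable_eval_C01)
  qed
qed

text \<open>Cylinders are an intersection-stable generator, and each depends only on the vector of
  increments at some level \<open>m \<ge> n\<close>. The law of that vector is determined by its
  values on rectangles.\<close>

lemma measure_C01_eqI_increments:
  assumes \<mu>: "finite_measure \<mu>" "sets \<mu> = sets C01" and \<nu>: "sets \<nu> = sets C01"
    and eq: "\<And>m A. n \<le> m \<Longrightarrow> range A \<subseteq> sets borel \<Longrightarrow>
      emeasure \<mu> {x \<in> space C01. \<forall>j\<le>2 ^ m. increment m x j \<in> A j} =
      emeasure \<nu> {x \<in> space C01. \<forall>j\<le>2 ^ m. increment m x j \<in> A j}"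
  shows "\<mu> = \<nu>"
proof (rule measure_eqI_generator_eq[OF Int_stable_cylinders])
  show "cylinders \<subseteq> Pow (space C01)"
    by (auto simp: cylinders_def cylinder_def)
  show "sets \<mu> = sigma_sets (space C01) cylinders" "sets \<nu> = sigma_sets (space C01) cylinders"
    using \<mu> \<nu> sets_C01_cylinders by auto
  show "range (\<lambda>_. space C01) \<subseteq> cylinders" "(\<Union>_::nat. space C01) = space C01"
    using space_C01_in_cylinders by auto
  show "emeasure \<mu> (space C01) \<noteq> \<infinity>" for i :: nat
    using finite_measure.emeasure_finite[OF \<mu>(1)] by simp
  fix E assume "E \<in> cylinders"
  then obtain T A where T: "finite T" "T \<subseteq> dyadic_points" and A: "range A \<subseteq> sets borel" and E: "E = cylinder T A"
    by (auto simp: cylinders_def)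
  obtain m where "n \<le> m" and m: "T \<subseteq> (\<lambda>j::nat. real j / 2 ^ m) ` {..2 ^ m}"
    using finite_subset_dyadic_points[OF T] unfolding dyadic_grid_def by blast
  let ?I = "{..(2::nat) ^ m}"
  let ?P = "PiM ?I (\<lambda>_. borel :: real measure)"
  let ?D = "\<lambda>x. \<lambda>j\<in>?I. increment m x j"
  have D [measurable]: "?D \<in> measurable C01 ?P"
    by (intro measurable_restrict) auto
  have D\<mu>: "?D \<in> measurable \<mu> ?P" and D\<nu>: "?D \<in> measurable \<nu> ?P"
    using \<mu> \<nu> D by (simp_all cong: measurable_cong_sets)
  have sp: "space \<mu> = space C01" "space \<nu> = space C01"
    by (rule sets_eq_imp_space_eq[OF \<mu>(2)], rule sets_eq_imp_space_eq[OF \<nu>])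
  have law: "distr \<mu> ?P ?D = distr \<nu> ?P ?D"
  proof (rule measure_eqI_PiM_finite)
    fix A :: "nat \<Rightarrow> real set" assume A: "\<And>i. i \<in> ?I \<Longrightarrow> A i \<in> sets borel"
    \<comment> \<open>The sets \<open>A i\<close> are known to be Borel for
      \<open>i \<in> ?I\<close> only; the default \<open>{}\<close> makes the whole family
      Borel.\<close>
    define A' where "A' i = (if i \<in> ?I then A i else {})" for i
    have "emeasure \<mu> {x \<in> space C01. \<forall>j\<le>2 ^ m. increment m x j \<in> A' j} =
        emeasure \<nu> {x \<in> space C01. \<forall>j\<le>2 ^ m. increment m x j \<in> A' j}"
      using A by (intro eq \<open>n \<le> m\<close>) (auto simp: A'_def)
    also have "{x \<in> space C01. \<forall>j\<le>2 ^ m. increment m x j \<in> A' j} = ?D -` Pi\<^sub>E ?I A \<inter> space C01"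
      by (auto simp: A'_def PiE_iff)
    finally show "emeasure (distr \<mu> ?P ?D) (Pi\<^sub>E ?I A) = emeasure (distr \<nu> ?P ?D) (Pi\<^sub>E ?I A)"
      using A by (subst (1 2) emeasure_distr) (auto simp: D\<mu> D\<nu> sp intro!: sets_PiM_I_finite)
  next
    show "range (\<lambda>_::nat. space ?P) \<subseteq> prod_algebra ?I (\<lambda>_. borel)"
      by (auto simp: space_PiM intro!: prod_algebraI_finite)
    interpret finite_measure \<mu> by (rule \<mu>)
    show "emeasure (distr \<mu> ?P ?D) (space ?P) \<noteq> \<infinity>" for i :: nat
      by (subst emeasure_distr) (auto simp: D\<mu>)
  qed auto
  \<comment> \<open>The cylinder constrains partial sums, so in increment coordinates it is not a
    rectangle. This is why equality of the full laws is established first.\<close>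
  let ?B = "{y \<in> space ?P. \<forall>j\<in>?I. real j / 2 ^ m \<in> T \<longrightarrow> (\<Sum>i\<le>j. y i) \<in> A (real j / 2 ^ m)}"
  have B: "?B \<in> sets ?P"
  proof (intro sets.sets_Collect_finite_All' sets.sets_Collect_imp sets.sets_Collect_const)
    fix j :: nat assume j: "j \<in> ?I"
    have [measurable]: "(\<lambda>y. \<Sum>i\<le>j. y i) \<in> borel_measurable ?P"
      using j by (intro borel_measurable_sum measurable_component_singleton) auto
    have [measurable]: "A (real j / 2 ^ m) \<in> sets borel" using A by auto
    show "{y \<in> space ?P. (\<Sum>i\<le>j. y i) \<in> A (real j / 2 ^ m)} \<in> sets ?P" by measurable
  qed auto
  have E': "E = ?D -` ?B \<inter> space C01"
  proof -
    have "(\<Sum>i\<le>j. ?D x i) = x (real j / 2 ^ m)" if "j \<le> 2 ^ m" for j x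
      using that by (subst sum_increment[symmetric]) (auto intro!: sum.cong)
    then show ?thesis
      using m measurable_space[OF D] by (auto simp: E cylinder_def)
  qed
  have "emeasure (distr \<mu> ?P ?D) ?B = emeasure (distr \<nu> ?P ?D) ?B"
    by (simp only: law)
  then show "emeasure \<mu> E = emeasure \<nu> E"
    by (simp only: emeasure_distr[OF D\<mu> B] emeasure_distr[OF D\<nu> B] sp E')
qed

lemma measurable_C01I:
  assumes "\<And>\<omega>. \<omega> \<in> space M \<Longrightarrow> X \<omega> \<in> space C01"
    and "\<And>t. t \<in> {0..1} \<Longrightarrow> (\<lambda>\<omega>. X \<omega> t) \<in> borel_measurable M"
  shows "X \<in> measurable M C01"
proof (rule measurable_sigma_sets[OF sets_C01_cylinders])
  show "cylinders \<subseteq> Pow (space C01)"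
    by (auto simp: cylinders_def cylinder_def)
  show "X \<in> space M \<rightarrow> space C01" using assms by auto
  fix E assume "E \<in> cylinders"
  then obtain T A where T: "finite T" "T \<subseteq> dyadic_points" and A: "range A \<subseteq> sets borel" and E: "E = cylinder T A"
    by (auto simp: cylinders_def)
  have "X -` E \<inter> space M = {\<omega> \<in> space M. \<forall>t\<in>T. X \<omega> t \<in> A t}"
    using assms(1) by (auto simp: E cylinder_def)
  also have "\<dots> \<in> sets M"
  proof (intro sets.sets_Collect_finite_All \<open>finite T\<close>)
    fix t assume "t \<in> T"
    then have [measurable]: "(\<lambda>\<omega>. X \<omega> t) \<in> borel_measurable M" "A t \<in> sets borel"
      using assms(2) T A dyadic_points_subset by auto
    show "{\<omega> \<in> space M. X \<omega> t \<in> A t} \<in> sets M" by measurable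
  qed
  finally show "X -` E \<inter> space M \<in> sets M" .
qed

section \<open>Uniqueness of the Laplace transform\<close>

text \<open>Strong induction: once the coefficients below \<open>m\<close> vanish, dividing by
  \<open>x ^ m\<close> leaves a series that is zero off the origin, and its limit at the origin is
  \<open>a m\<close>.\<close>

lemma powser_sums_0_imp_coeff_0:
  fixes a :: "nat \<Rightarrow> real"
  assumes "\<And>x. (\<lambda>n. a n * x ^ n) sums 0"
  shows "a m = 0"
proof (induction m rule: less_induct)
  case (less m)
  have "(\<lambda>n. a (n + m) * x ^ n) sums 0" if "x \<noteq> 0" for x
  proof -
    have "(\<lambda>n. a (n + m) * x ^ (n + m)) sums (0 - (\<Sum>n<m. a n * x ^ n))"
      by (rule sums_split_initial_segment[OF assms])
    also have "(\<Sum>n<m. a n * x ^ n) = 0"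
      using less by simp
    finally have "(\<lambda>n. a (n + m) * x ^ (n + m) * inverse (x ^ m)) sums (0 * inverse (x ^ m))"
      by (intro sums_mult2) simp
    then show ?thesis
      using that by (simp add: power_add field_simps)
  qed
  note shifted = this
  have "((\<lambda>_. 0 :: real) \<longlongrightarrow> a (0 + m)) (at (0 :: real))"
    by (rule powser_limit_0_strong[where s = 1 and a = "\<lambda>n. a (n + m)"]) (auto intro: shifted)
  then show ?case
    using tendsto_unique[OF _ tendsto_const] by (metis add_0 trivial_limit_at)
qed

section \<open>From the Laplace transform to the Fourier transform\<close>

lemma sum_power_div_fact_le_exp:
  fixes x :: real
  assumes "0 \<le> x"
  shows "(\<Sum>n<N. x ^ n / fact n) \<le> exp x"
proof -
  have "(\<lambda>n. x ^ n / fact n) sums exp x"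
    using exp_converges[of x] by (simp add: divide_inverse mult.commute)
  then show ?thesis
    using assms sum_le_suminf[of "\<lambda>n. x ^ n / fact n" "{..<N}"] by (auto simp: sums_iff)
qed

text \<open>The exponential series is integrated term by term by dominated convergence. Since
  \<open>z\<close> is complex, the same real moments describe the transform on the real and on the
  imaginary axis.\<close>

lemma laplace_transform_power_series:
  fixes V D :: "'a \<Rightarrow> real" and z :: complex
  assumes [measurable]: "D \<in> borel_measurable M"
    and int: "\<And>c. integrable M (\<lambda>\<omega>. V \<omega> * exp (c * D \<omega>))"
  shows "(\<lambda>n. (LINT \<omega>|M. V \<omega> * D \<omega> ^ n) / fact n * z ^ n) sums (LINT \<omega>|M. V \<omega> * exp (z * D \<omega>))"
proof -
  have [measurable]: "V \<in> borel_measurable M"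
    using int[of 0] by (simp add: borel_measurable_integrable)
  \<comment> \<open>As \<open>\<bar>D\<bar>\<close> is either \<open>D\<close> or
    \<open>- D\<close>, the exponential moments at \<open>r\<close> and \<open>- r\<close> together
    dominate.\<close>
  have dom: "integrable M (\<lambda>\<omega>. \<bar>V \<omega>\<bar> * exp (r * \<bar>D \<omega>\<bar>))" for r
  proof (rule Bochner_Integration.integrable_bound)
    show "integrable M (\<lambda>\<omega>. \<bar>V \<omega> * exp (r * D \<omega>)\<bar> + \<bar>V \<omega> * exp (-r * D \<omega>)\<bar>)"
      by (intro Bochner_Integration.integrable_add integrable_abs int)
    show "AE \<omega> in M. norm (\<bar>V \<omega>\<bar> * exp (r * \<bar>D \<omega>\<bar>))
        \<le> norm (\<bar>V \<omega> * exp (r * D \<omega>)\<bar> + \<bar>V \<omega> * exp (-r * D \<omega>)\<bar>)"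
      by (auto simp: abs_mult abs_if[of "D _"])
  qed simp
  have pow: "integrable M (\<lambda>\<omega>. V \<omega> * D \<omega> ^ n)" for n
  proof (rule Bochner_Integration.integrable_bound)
    show "integrable M (\<lambda>\<omega>. fact n * (\<bar>V \<omega>\<bar> * exp (1 * \<bar>D \<omega>\<bar>)))"
      by (intro integrable_mult_right dom)
    \<comment> \<open>A single term of the exponential series is at most its sum, so exponential
      moments control the moments of every order.\<close>
    have *: "\<bar>x\<bar> ^ n \<le> fact n * exp \<bar>x\<bar>" for x :: real
    proof -
      have "\<bar>x\<bar> ^ n / fact n \<le> (\<Sum>k<Suc n. \<bar>x\<bar> ^ k / fact k)"
        by (simp add: sum_nonneg)
      also have "\<dots> \<le> exp \<bar>x\<bar>"
        by (rule sum_power_div_fact_le_exp) simp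
      finally show ?thesis by (simp add: field_simps)
    qed
    have "\<bar>v\<bar> * \<bar>x\<bar> ^ n \<le> fact n * (\<bar>v\<bar> * exp \<bar>x\<bar>)" for v x :: real
      using mult_left_mono[OF *[of x], of "\<bar>v\<bar>"] by (simp add: mult_ac)
    then show "AE \<omega> in M. norm (V \<omega> * D \<omega> ^ n) \<le> norm (fact n * (\<bar>V \<omega>\<bar> * exp (1 * \<bar>D \<omega>\<bar>)))"
      by (auto simp: abs_mult power_abs)
  qed simp
  let ?s = "\<lambda>N \<omega>. \<Sum>n<N. of_real (V \<omega> * D \<omega> ^ n) * (z ^ n / fact n)"
  have "(\<lambda>N. LINT \<omega>|M. ?s N \<omega>) \<longlonglongrightarrow> (LINT \<omega>|M. V \<omega> * exp (z * D \<omega>))"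
  proof (rule integral_dominated_convergence[where w = "\<lambda>\<omega>. \<bar>V \<omega>\<bar> * exp (cmod z * \<bar>D \<omega>\<bar>)"])
    have "(\<lambda>N. ?s N \<omega>) \<longlonglongrightarrow> V \<omega> * exp (z * D \<omega>)" for \<omega>
    proof -
      have "(\<lambda>n. of_real (V \<omega>) * ((z * D \<omega>) ^ n /\<^sub>R fact n)) sums (V \<omega> * exp (z * D \<omega>))"
        by (intro sums_mult exp_converges)
      also have "(\<lambda>n. of_real (V \<omega>) * ((z * D \<omega>) ^ n /\<^sub>R fact n))
          = (\<lambda>n. of_real (V \<omega> * D \<omega> ^ n) * (z ^ n / fact n))"
        by (auto simp: power_mult_distrib scaleR_conv_of_real divide_inverse mult_ac)
      finally show ?thesis by (simp add: sums_def)
    qed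
    then show "AE \<omega> in M. (\<lambda>N. ?s N \<omega>) \<longlonglongrightarrow> V \<omega> * exp (z * D \<omega>)" by simp
    have "norm (?s N \<omega>) \<le> \<bar>V \<omega>\<bar> * exp (cmod z * \<bar>D \<omega>\<bar>)" for N \<omega>
    proof -
      have "norm (?s N \<omega>) \<le> (\<Sum>n<N. \<bar>V \<omega>\<bar> * ((cmod z * \<bar>D \<omega>\<bar>) ^ n / fact n))"
        by (intro norm_sum[THEN order_trans] sum_mono)
           (simp add: norm_mult norm_divide norm_power abs_mult power_abs power_mult_distrib mult_ac)
      also have "\<dots> = \<bar>V \<omega>\<bar> * (\<Sum>n<N. (cmod z * \<bar>D \<omega>\<bar>) ^ n / fact n)"
        by (simp add: sum_distrib_left)
      also have "\<dots> \<le> \<bar>V \<omega>\<bar> * exp (cmod z * \<bar>D \<omega>\<bar>)"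
        by (intro mult_left_mono sum_power_div_fact_le_exp) auto
      finally show ?thesis .
    qed
    then show "\<And>N. AE \<omega> in M. norm (?s N \<omega>) \<le> \<bar>V \<omega>\<bar> * exp (cmod z * \<bar>D \<omega>\<bar>)" by simp
  qed (simp_all add: dom)
  also have "(\<lambda>N. LINT \<omega>|M. ?s N \<omega>) =
      (\<lambda>N. \<Sum>n<N. of_real ((LINT \<omega>|M. V \<omega> * D \<omega> ^ n) / fact n) * z ^ n)"
    by (intro ext, subst Bochner_Integration.integral_sum)
       (auto simp del: of_real_mult intro!: integrable_mult_left integrable_of_real pow sum.cong)
  finally show ?thesis by (simp add: sums_def)
qed

text \<open>Analytic continuation through the coefficients: vanishing at real arguments makes every
  moment zero, hence the series also vanishes at \<open>\<i> * t\<close>.\<close>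

lemma laplace_zero_imp_fourier_zero:
  fixes V D :: "'a \<Rightarrow> real"
  assumes D: "D \<in> borel_measurable M"
    and int: "\<And>c. integrable M (\<lambda>\<omega>. V \<omega> * exp (c * D \<omega>))"
    and zero: "\<And>c. (LINT \<omega>|M. V \<omega> * exp (c * D \<omega>)) = 0"
  shows "(LINT \<omega>|M. V \<omega> * iexp (t * D \<omega>)) = 0"
proof -
  let ?a = "\<lambda>n. (LINT \<omega>|M. V \<omega> * D \<omega> ^ n) / fact n"
  have "(\<lambda>n. ?a n * x ^ n) sums 0" for x
  proof -
    have "(\<lambda>n. ?a n * complex_of_real x ^ n) sums (LINT \<omega>|M. V \<omega> * exp (complex_of_real x * D \<omega>))"
      by (rule laplace_transform_power_series[OF D int])
    also have "(LINT \<omega>|M. V \<omega> * exp (complex_of_real x * D \<omega>))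
        = (LINT \<omega>|M. complex_of_real (V \<omega> * exp (x * D \<omega>)))"
      by (simp flip: exp_of_real)
    also have "\<dots> = of_real 0"
      by (subst integral_complex_of_real) (simp add: zero)
    finally have "(\<lambda>n. complex_of_real (?a n * x ^ n)) sums of_real 0" by simp
    then show ?thesis by (simp only: sums_of_real_iff)
  qed
  then have "?a n = 0" for n
    by (rule powser_sums_0_imp_coeff_0)
  moreover have "(\<lambda>n. ?a n * (\<i> * t) ^ n) sums (LINT \<omega>|M. V \<omega> * exp (\<i> * t * D \<omega>))"
    by (rule laplace_transform_power_series[OF D int])
  ultimately have "(\<lambda>n. 0) sums (LINT \<omega>|M. V \<omega> * exp (\<i> * t * D \<omega>))"
    by (simp del: div_eq_0_iff divide_eq_0_iff)
  then have "(LINT \<omega>|M. V \<omega> * exp (\<i> * t * D \<omega>)) = 0"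
    using sums_0 sums_unique2 by blast
  then show ?thesis by (simp add: mult_ac)
qed

text \<open>The positive and negative parts of \<open>V\<close> weight \<open>M\<close> to give two
  laws of \<open>D\<close>. Their Fourier transforms agree, so Levy's uniqueness theorem identifies
  them.\<close>

lemma laplace_zero_imp_integral_indicator_zero:
  fixes V D :: "'a \<Rightarrow> real"
  assumes D [measurable]: "D \<in> borel_measurable M"
    and int: "\<And>c. integrable M (\<lambda>\<omega>. V \<omega> * exp (c * D \<omega>))"
    and zero: "\<And>c. (LINT \<omega>|M. V \<omega> * exp (c * D \<omega>)) = 0"
    and B [measurable]: "B \<in> sets borel"
  shows "(LINT \<omega>|M. V \<omega> * indicator B (D \<omega>)) = 0"
proof -
  have V: "integrable M V" "(LINT \<omega>|M. V \<omega>) = 0"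
    using int[of 0] zero[of 0] by simp_all
  then have [measurable]: "V \<in> borel_measurable M"
    by (simp add: borel_measurable_integrable)
  \<comment> \<open>The case \<open>c = 0\<close> gives both parts of \<open>V\<close> the same mass
    \<open>m\<close>. If \<open>m = 0\<close>, then \<open>V\<close> vanishes almost everywhere;
    otherwise dividing by \<open>m\<close> yields probability measures.\<close>
  define m where "m = (LINT \<omega>|M. max 0 (V \<omega>))"
  have split: "V \<omega> = max 0 (V \<omega>) - max 0 (- V \<omega>)" for \<omega> by auto
  have intp: "integrable M (\<lambda>\<omega>. max 0 (V \<omega>))" "integrable M (\<lambda>\<omega>. max 0 (- V \<omega>))"
    using V by auto
  have m': "(LINT \<omega>|M. max 0 (- V \<omega>)) = m"
  proof -
    have "(LINT \<omega>|M. V \<omega>) = (LINT \<omega>|M. max 0 (V \<omega>)) - (LINT \<omega>|M. max 0 (- V \<omega>))"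
      by (subst split) (rule Bochner_Integration.integral_diff[OF intp])
    then show ?thesis using V by (simp add: m_def)
  qed
  show ?thesis
  proof (cases "m = 0")
    case True
    then have "AE \<omega> in M. max 0 (V \<omega>) = 0" "AE \<omega> in M. max 0 (- V \<omega>) = 0"
      using integral_nonneg_eq_0_iff_AE[OF intp(1)] integral_nonneg_eq_0_iff_AE[OF intp(2)] m'
      by (simp_all add: m_def)
    then have "AE \<omega> in M. V \<omega> * indicator B (D \<omega>) = 0"
      by eventually_elim auto
    then show ?thesis by (rule integral_eq_zero_AE)
  next
    case False
    moreover have "0 \<le> m" unfolding m_def by (intro integral_nonneg_AE) auto
    ultimately have "0 < m" by simp
    define P where "P U = distr (density M (\<lambda>\<omega>. ennreal (max 0 (U \<omega>) / m))) borel D" for U :: "'a \<Rightarrow> real"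
    have real: "real_distribution (P U)"
      if [measurable]: "U \<in> borel_measurable M" and i: "integrable M (\<lambda>\<omega>. max 0 (U \<omega>))"
        and m: "(LINT \<omega>|M. max 0 (U \<omega>)) = m" for U
    proof -
      have "emeasure (density M (\<lambda>\<omega>. ennreal (max 0 (U \<omega>) / m))) (space M)
          = (\<integral>\<^sup>+\<omega>. ennreal (max 0 (U \<omega>) / m) \<partial>M)"
        by (subst emeasure_density) (auto intro!: nn_integral_cong)
      also have "\<dots> = ennreal (LINT \<omega>|M. max 0 (U \<omega>) / m)"
        using i \<open>0 < m\<close> by (intro nn_integral_eq_integral) auto
      also have "\<dots> = 1" using m \<open>0 < m\<close> by simp
      finally interpret d: prob_space "density M (\<lambda>\<omega>. ennreal (max 0 (U \<omega>) / m))"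
        by (intro prob_spaceI) simp
      show ?thesis unfolding P_def
        by (intro d.real_distribution_distr) simp
    qed
    have char: "char (P U) t = (LINT \<omega>|M. complex_of_real (max 0 (U \<omega>)) * iexp (t * D \<omega>)) / m"
      if [measurable]: "U \<in> borel_measurable M" for U t
    proof -
      have "char (P U) t = (LINT \<omega>|M. (max 0 (U \<omega>) / m) *\<^sub>R iexp (t * D \<omega>))"
        (is "_ = integral\<^sup>L M ?f")
        unfolding char_def P_def using \<open>0 < m\<close>
        by (subst integral_distr, simp, simp, subst integral_density) auto
      also have "?f = (\<lambda>\<omega>. complex_of_real (max 0 (U \<omega>)) * iexp (t * D \<omega>) / complex_of_real m)"
        unfolding scaleR_conv_of_real of_real_divide by auto
      also have "integral\<^sup>L M \<dots> = (LINT \<omega>|M. complex_of_real (max 0 (U \<omega>)) * iexp (t * D \<omega>)) / complex_of_real m"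
        by (rule integral_divide_zero)
      finally show ?thesis .
    qed
    have meas: "measure (P U) B = (LINT \<omega>|M. max 0 (U \<omega>) * indicator B (D \<omega>)) / m"
      if [measurable]: "U \<in> borel_measurable M" for U
    proof -
      have "measure (P U) B = (LINT x|P U. indicator B x)"
        by (simp add: P_def)
      also have "\<dots> = (LINT \<omega>|M. (max 0 (U \<omega>) / m) *\<^sub>R indicator B (D \<omega>))"
        unfolding P_def using \<open>0 < m\<close>
        by (subst integral_distr, simp, simp, subst integral_density) auto
      also have "\<dots> = (LINT \<omega>|M. (max 0 (U \<omega>) * indicator B (D \<omega>)) / m)"
        by simp
      finally show ?thesis by simp
    qed
    have "char (P V) = char (P (\<lambda>\<omega>. - V \<omega>))"
    proof
      fix t
      have bound: "integrable M (\<lambda>\<omega>. complex_of_real (max 0 (U \<omega>)) * iexp (t * D \<omega>))"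
        if "integrable M (\<lambda>\<omega>. max 0 (U \<omega>))" "U \<in> borel_measurable M" for U
        by (rule Bochner_Integration.integrable_bound[OF that(1)])
           (use that in \<open>auto simp: norm_mult\<close>)
      have "(LINT \<omega>|M. V \<omega> * iexp (t * D \<omega>))
          = (LINT \<omega>|M. complex_of_real (max 0 (V \<omega>)) * iexp (t * D \<omega>) - complex_of_real (max 0 (- V \<omega>)) * iexp (t * D \<omega>))"
        by (intro Bochner_Integration.integral_cong refl, subst split)
           (simp only: of_real_diff left_diff_distrib)
      also have "\<dots> = (LINT \<omega>|M. complex_of_real (max 0 (V \<omega>)) * iexp (t * D \<omega>)) - (LINT \<omega>|M. complex_of_real (max 0 (- V \<omega>)) * iexp (t * D \<omega>))"
        by (intro Bochner_Integration.integral_diff bound intp) auto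
      finally show "char (P V) t = char (P (\<lambda>\<omega>. - V \<omega>)) t"
        using laplace_zero_imp_fourier_zero[OF D int zero, of t] by (simp add: char)
    qed
    then have "P V = P (\<lambda>\<omega>. - V \<omega>)"
      by (intro Levy_uniqueness real) (use intp m' in \<open>auto simp: m_def\<close>)
    then have eq: "(LINT \<omega>|M. max 0 (V \<omega>) * indicator B (D \<omega>)) = (LINT \<omega>|M. max 0 (- V \<omega>) * indicator B (D \<omega>))"
      using meas[of V] meas[of "\<lambda>\<omega>. - V \<omega>"] \<open>0 < m\<close> by simp
    have bound: "integrable M (\<lambda>\<omega>. max 0 (U \<omega>) * indicator B (D \<omega>))"
      if "integrable M (\<lambda>\<omega>. max 0 (U \<omega>))" "U \<in> borel_measurable M" for U :: "'a \<Rightarrow> real"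
      by (rule Bochner_Integration.integrable_bound[OF that(1)])
         (use that in \<open>auto simp: norm_mult indicator_def\<close>)
    have "(LINT \<omega>|M. V \<omega> * indicator B (D \<omega>))
        = (LINT \<omega>|M. max 0 (V \<omega>) * indicator B (D \<omega>) - max 0 (- V \<omega>) * indicator B (D \<omega>))"
      by (intro Bochner_Integration.integral_cong refl, subst split) (simp add: algebra_simps)
    also have "\<dots> = (LINT \<omega>|M. max 0 (V \<omega>) * indicator B (D \<omega>)) - (LINT \<omega>|M. max 0 (- V \<omega>) * indicator B (D \<omega>))"
      by (intro Bochner_Integration.integral_diff bound intp) auto
    finally show ?thesis using eq by simp
  qed
qed

text \<open>Exponential factors are exchanged for indicators one coordinate at a time. The induction
  is over all \<open>V\<close>, because each new indicator is absorbed into the weight.\<close>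

lemma laplace_zero_imp_integral_prod_indicator_zero:
  fixes V :: "'a \<Rightarrow> real" and D :: "'i \<Rightarrow> 'a \<Rightarrow> real"
  assumes "finite I"
    and "\<And>i. i \<in> I \<Longrightarrow> D i \<in> borel_measurable M"
    and "\<And>c. integrable M (\<lambda>\<omega>. V \<omega> * exp (\<Sum>i\<in>I. c i * D i \<omega>))"
    and "\<And>c. (LINT \<omega>|M. V \<omega> * exp (\<Sum>i\<in>I. c i * D i \<omega>)) = 0"
    and "\<And>i. i \<in> I \<Longrightarrow> B i \<in> sets borel"
  shows "(LINT \<omega>|M. V \<omega> * (\<Prod>i\<in>I. indicator (B i) (D i \<omega>))) = 0"
  using assms
proof (induction I arbitrary: V rule: finite_induct)
  case empty
  then show ?case by simp
next
  case (insert k I)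
  note int = insert.prems(2) and zero = insert.prems(3)
  have [measurable]: "D k \<in> borel_measurable M" "B k \<in> sets borel"
    using insert.prems by auto
  have upd: "(\<Sum>i\<in>insert k I. (c(k := s)) i * D i \<omega>) = s * D k \<omega> + (\<Sum>i\<in>I. c i * D i \<omega>)" for c s \<omega>
  proof -
    have "(\<Sum>i\<in>I. (c(k := s)) i * D i \<omega>) = (\<Sum>i\<in>I. c i * D i \<omega>)"
      using insert.hyps by (intro sum.cong) auto
    then show ?thesis using insert.hyps by simp
  qed
  let ?V = "\<lambda>\<omega>. V \<omega> * indicator (B k) (D k \<omega>)"
  have "integrable M (\<lambda>\<omega>. ?V \<omega> * exp (\<Sum>i\<in>I. c i * D i \<omega>))" for c
  proof -
    have "integrable M (\<lambda>\<omega>. V \<omega> * exp (\<Sum>i\<in>I. c i * D i \<omega>))"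
      using int[of "c(k := 0)"] unfolding upd by simp
    then have "integrable M (\<lambda>\<omega>. indicator (D k -` B k \<inter> space M) \<omega> *\<^sub>R (V \<omega> * exp (\<Sum>i\<in>I. c i * D i \<omega>)))"
      by (intro integrable_mult_indicator) auto
    then show ?thesis
      by (rule Bochner_Integration.integrable_cong[THEN iffD1, rotated -1])
         (auto simp: indicator_def)
  qed
  moreover have "(LINT \<omega>|M. ?V \<omega> * exp (\<Sum>i\<in>I. c i * D i \<omega>)) = 0" for c
  proof -
    \<comment> \<open>The one-dimensional result is applied to \<open>D k\<close>, with the
      exponential of the other coordinates as part of the weight.\<close>
    have "(LINT \<omega>|M. (V \<omega> * exp (\<Sum>i\<in>I. c i * D i \<omega>)) * indicator (B k) (D k \<omega>)) = 0"
    proof (rule laplace_zero_imp_integral_indicator_zero)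
      show "integrable M (\<lambda>\<omega>. V \<omega> * exp (\<Sum>i\<in>I. c i * D i \<omega>) * exp (s * D k \<omega>))" for s
        using int[of "c(k := s)"] unfolding upd by (simp add: exp_add mult_ac)
      show "(LINT \<omega>|M. V \<omega> * exp (\<Sum>i\<in>I. c i * D i \<omega>) * exp (s * D k \<omega>)) = 0" for s
        using zero[of "c(k := s)"] unfolding upd by (simp add: exp_add mult_ac)
    qed auto
    then show ?thesis by (simp add: mult_ac)
  qed
  ultimately have "(LINT \<omega>|M. ?V \<omega> * (\<Prod>i\<in>I. indicator (B i) (D i \<omega>))) = 0"
    by (intro insert.IH) (use insert.prems in auto)
  then show ?case
    using insert.hyps by (simp add: mult_ac)
qed

section \<open>Cadlag drifts and dyadic step functions\<close>

text \<open>One-sided limits give bounds on both sides of \<open>t\<close>, and the value at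
  \<open>t\<close> is added separately. At an end point the side outside \<open>{0..1}\<close> is
  vacuous.\<close>

lemma D01_locally_bounded:
  assumes "\<theta> \<in> D01" "t \<in> {0..1}"
  shows "\<exists>B. \<forall>\<^sub>F s in nhds t. s \<in> {0..1} \<longrightarrow> \<bar>\<theta> s\<bar> \<le> B"
proof -
  have lim: "\<forall>\<^sub>F s in F. \<bar>\<theta> s\<bar> \<le> \<bar>l\<bar> + 1" if "(\<theta> \<longlongrightarrow> l) F" for l F
    using order_tendstoD(2)[OF tendsto_rabs[OF that], of "\<bar>l\<bar> + 1"]
    by (auto elim: eventually_mono)
  have "\<exists>B. \<forall>\<^sub>F s in at_right t. s \<in> {0..1} \<longrightarrow> \<bar>\<theta> s\<bar> \<le> B"
  proof (cases "t < 1")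
    case True
    then show ?thesis
      using assms lim[of "\<theta> t" "at_right t"]
      by (intro exI[of _ "\<bar>\<theta> t\<bar> + 1"]) (auto simp: D01_def elim: eventually_mono)
  next
    case False
    then have "\<forall>\<^sub>F s in at_right t. s \<notin> {0..1}"
      by (auto simp: eventually_at_filter)
    then show ?thesis by (auto elim: eventually_mono)
  qed
  then obtain B where B: "\<forall>\<^sub>F s in at_right t. s \<in> {0..1} \<longrightarrow> \<bar>\<theta> s\<bar> \<le> B" ..
  have "\<exists>B. \<forall>\<^sub>F s in at_left t. s \<in> {0..1} \<longrightarrow> \<bar>\<theta> s\<bar> \<le> B"
  proof (cases "0 < t")
    case True
    then have "\<exists>l. (\<theta> \<longlongrightarrow> l) (at_left t)"
      using assms by (auto simp: D01_def)
    then obtain l where "(\<theta> \<longlongrightarrow> l) (at_left t)" ..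
    then show ?thesis
      using lim[of l "at_left t"]
      by (intro exI[of _ "\<bar>l\<bar> + 1"]) (auto elim: eventually_mono)
  next
    case False
    then have "\<forall>\<^sub>F s in at_left t. s \<notin> {0..1}"
      by (auto simp: eventually_at_filter)
    then show ?thesis by (auto elim: eventually_mono)
  qed
  then obtain B' where B': "\<forall>\<^sub>F s in at_left t. s \<in> {0..1} \<longrightarrow> \<bar>\<theta> s\<bar> \<le> B'" ..
  let ?B = "max \<bar>\<theta> t\<bar> (max B B')"
  have "\<forall>\<^sub>F s in at t. s \<in> {0..1} \<longrightarrow> \<bar>\<theta> s\<bar> \<le> ?B"
    unfolding eventually_at_split using B B' by (auto elim!: eventually_mono)
  then have "\<forall>\<^sub>F s in nhds t. s \<in> {0..1} \<longrightarrow> \<bar>\<theta> s\<bar> \<le> ?B"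
    unfolding eventually_at_filter by eventually_elim (metis UNIV_I max.cobounded1)
  then show ?thesis ..
qed

text \<open>Compactness leaves finitely many local bounds; the sum of their absolute values
  dominates each of them.\<close>

lemma D01_bounded:
  assumes "\<theta> \<in> D01"
  shows "\<exists>B. \<forall>s\<in>{0..1}. \<bar>\<theta> s\<bar> \<le> B"
proof -
  have "\<forall>t\<in>{0..1}. \<exists>B U. open U \<and> t \<in> U \<and> (\<forall>s\<in>U. s \<in> {0..1} \<longrightarrow> \<bar>\<theta> s\<bar> \<le> B)"
    using D01_locally_bounded[OF assms] unfolding eventually_nhds by blast
  then obtain B U where U: "\<And>t. t \<in> {0..1} \<Longrightarrow> open (U t) \<and> t \<in> U t \<and> (\<forall>s\<in>U t. s \<in> {0..1} \<longrightarrow> \<bar>\<theta> s\<bar> \<le> B t)"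
    by metis
  have "\<exists>T\<subseteq>{0..1}. finite T \<and> {0..1} \<subseteq> (\<Union>t\<in>T. U t)"
    by (rule compactE_image[of "{0..1::real}" "{0..1}" U]) (use U in blast)+
  then obtain T where T: "T \<subseteq> {0..1}" "finite T" "{0..1} \<subseteq> (\<Union>t\<in>T. U t)"
    by blast
  have "\<bar>\<theta> s\<bar> \<le> (\<Sum>t\<in>T. \<bar>B t\<bar>)" if s: "s \<in> {0..1}" for s
  proof -
    obtain t where t: "t \<in> T" "s \<in> U t" using T s by blast
    then have "\<bar>\<theta> s\<bar> \<le> B t" using U[of t] T s by blast
    then have "\<bar>\<theta> s\<bar> \<le> \<bar>B t\<bar>" by simp
    also have "\<dots> \<le> (\<Sum>t\<in>T. \<bar>B t\<bar>)"
      using t T by (intro member_le_sum) auto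
    finally show ?thesis .
  qed
  then show ?thesis by blast
qed

text \<open>Evaluating at the right end points of dyadic intervals, right continuity makes \<open>\<theta>\<close> a
  pointwise limit of functions that factor through \<open>floor\<close>.\<close>

lemma D01_measurable:
  assumes "\<theta> \<in> D01"
  shows "(\<lambda>t. indicator {0..1} t *\<^sub>R \<theta> t) \<in> borel_measurable borel"
proof -
  let ?p = "\<lambda>n::nat. \<lambda>t::real. real_of_int (\<lfloor>2 ^ n * t\<rfloor> + 1) / 2 ^ n"
  have "(\<lambda>t. indicator {0..<1} t * \<theta> t) \<in> borel_measurable borel"
  proof (rule borel_measurable_LIMSEQ_real)
    fix t :: real
    show "(\<lambda>n. indicator {0..<1} t * \<theta> (?p n t)) \<longlonglongrightarrow> indicator {0..<1} t * \<theta> t"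
    proof (cases "t \<in> {0..<1}")
      case True
      \<comment> \<open>Strictness makes the approximating points converge along
        \<open>at_right t\<close>, where right continuity applies.\<close>
      have less: "t < ?p n t" for n
        by (simp add: pos_less_divide_eq mult.commute)
      have le: "?p n t \<le> t + (1 / 2) ^ n" for n
      proof -
        have "?p n t \<le> (2 ^ n * t + 1) / 2 ^ n"
          by (intro divide_right_mono) auto
        also have "\<dots> = t + (1 / 2) ^ n"
          by (simp add: add_divide_distrib power_one_over)
        finally show ?thesis .
      qed
      have "(\<lambda>n. ?p n t) \<longlonglongrightarrow> t"
      proof (rule tendsto_sandwich[where f = "\<lambda>_. t" and h = "\<lambda>n. t + (1 / 2) ^ n"])
        show "(\<lambda>n. t + (1 / 2) ^ n) \<longlonglongrightarrow> t"
          using tendsto_add[OF tendsto_const[of t] LIMSEQ_power_zero[of "1 / 2 :: real"]] by simp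
      qed (use less le in \<open>auto intro!: always_eventually simp: less_imp_le\<close>)
      then have "filterlim (\<lambda>n. ?p n t) (at_right t) sequentially"
        unfolding filterlim_at using less by (auto intro!: always_eventually simp: less_imp_neq[THEN not_sym])
      moreover have "(\<theta> \<longlongrightarrow> \<theta> t) (at_right t)"
        using assms True by (auto simp: D01_def)
      ultimately have "(\<lambda>n. \<theta> (?p n t)) \<longlonglongrightarrow> \<theta> t"
        by (rule filterlim_compose[rotated])
      then show ?thesis using True by simp
    qed simp
  next
    fix n :: nat
    have [measurable]: "(\<lambda>t::real. \<lfloor>2 ^ n * t\<rfloor>) \<in> measurable borel (count_space UNIV)"
      by measurable
    \<comment> \<open>Every function on the discrete integers is measurable, so nothing about
      measurability of \<open>\<theta>\<close> is presupposed.\<close>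
    have "(\<lambda>k. \<theta> (real_of_int (k + 1) / 2 ^ n)) \<in> measurable (count_space UNIV) borel"
      by simp
    from measurable_compose[OF _ this, of "\<lambda>t::real. \<lfloor>2 ^ n * t\<rfloor>" borel]
    have [measurable]: "(\<lambda>t. \<theta> (?p n t)) \<in> borel_measurable borel"
      by measurable
    show "(\<lambda>t. indicator {0..<1} t * \<theta> (?p n t)) \<in> borel_measurable borel"
      by measurable
  qed
  \<comment> \<open>Right continuity is available on \<open>{0..<1}\<close> only; the value at 1 is
    added by hand.\<close>
  then have "(\<lambda>t. indicator {0..<1} t * \<theta> t + indicator {1} t * \<theta> 1) \<in> borel_measurable borel"
    by measurable
  also have "(\<lambda>t. indicator {0..<1} t * \<theta> t + indicator {1} t * \<theta> 1) = (\<lambda>t. indicator {0..1} t *\<^sub>R \<theta> t)"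
    by (auto simp: indicator_def fun_eq_iff)
  finally show ?thesis .
qed

section \<open>Integrals of cadlag drifts\<close>

lemma D01_set_integrable:
  assumes "\<theta> \<in> D01" "u \<le> 1"
  shows "set_integrable lborel {0..u} \<theta>"
proof -
  obtain B where B: "\<And>s. s \<in> {0..1} \<Longrightarrow> \<bar>\<theta> s\<bar> \<le> B"
    using D01_bounded[OF assms(1)] by blast
  have "set_integrable lborel {0..1} \<theta>"
    unfolding set_integrable_def
  proof (rule Bochner_Integration.integrable_bound)
    show "integrable lborel (\<lambda>t::real. indicator {0..1} t * B)"
      by (intro integrable_mult_left integrable_real_indicator) auto
    show "(\<lambda>t. indicator {0..1} t *\<^sub>R \<theta> t) \<in> borel_measurable lborel"
      using D01_measurable[OF assms(1)] by simp
    show "AE t in lborel. norm (indicator {0..1} t *\<^sub>R \<theta> t) \<le> norm (indicator {0..1} t * B)"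
      using B by (auto simp: indicator_def intro!: AE_I2 order_trans[OF B])
  qed
  then show ?thesis
    by (rule set_integrable_subset) (use assms in auto)
qed

text \<open>Passing to the gauge integral gives access to continuity of indefinite integrals and
  additivity over adjacent intervals.\<close>

lemma D01_integral:
  assumes "\<theta> \<in> D01" "u \<le> 1"
  shows "\<theta> integrable_on {0..u}" "(LINT v:{0..u}|lborel. \<theta> v) = integral {0..u} \<theta>"
  using set_borel_integral_eq_integral[OF D01_set_integrable[OF assms]] by auto

lemma drift_path_in_C01:
  assumes "\<theta> \<in> D01" "continuous_on {0..1} (\<lambda>t. W t \<omega>)"
  shows "drift_path W \<theta> \<omega> \<in> space C01"
proof -
  have "continuous_on {0..1} (\<lambda>u. integral {0..u} \<theta> + W u \<omega>)"
    using D01_integral(1)[OF assms(1), of 1] assms(2)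
    by (intro continuous_on_add indefinite_integral_continuous_1) auto
  then show ?thesis
    using D01_integral(2)[OF assms(1)]
    by (auto simp: space_C01 drift_path_def cong: continuous_on_cong_simp)
qed

section \<open>Perturbing a drift by dyadic step functions\<close>

definition step :: "nat \<Rightarrow> (nat \<Rightarrow> real) \<Rightarrow> real \<Rightarrow> real" where
  "step n c t = c (nat \<lfloor>2 ^ n * t\<rfloor>)"

definition add_step :: "(real \<Rightarrow> real) \<Rightarrow> nat \<Rightarrow> (nat \<Rightarrow> real) \<Rightarrow> real \<Rightarrow> real" where
  "add_step \<theta> n c = (\<lambda>t\<in>{0..1}. \<theta> t + step n c t)"

text \<open>Dividing an index of the finer grid by \<open>2 ^ d\<close> gives the index of the
  coarse interval containing it. A step function can thus be rewritten on any finer grid.\<close>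

lemma step_refine:
  assumes "0 \<le> t"
  shows "step n c t = step (n + d) (\<lambda>j. c (j div 2 ^ d)) t"
proof -
  have "nat \<lfloor>2 ^ (n + d) * t\<rfloor> div 2 ^ d = nat (\<lfloor>2 ^ (n + d) * t\<rfloor> div 2 ^ d)"
    using assms by (simp add: nat_div_distrib nat_power_eq)
  also have "\<lfloor>2 ^ (n + d) * t\<rfloor> div 2 ^ d = \<lfloor>2 ^ (n + d) * t / 2 ^ d\<rfloor>"
    using floor_divide_real_eq_div[of "2 ^ d" "2 ^ (n + d) * t"] by simp
  also have "2 ^ (n + d) * t / 2 ^ d = 2 ^ n * t"
    by (simp add: power_add)
  finally show ?thesis by (simp add: step_def)
qed

text \<open>Close to \<open>t\<close>, on either side separately, the step function is constant, so
  the one-sided limits of \<open>\<theta>\<close> are merely shifted.\<close>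

lemma add_step_in_D01:
  assumes "\<theta> \<in> D01"
  shows "add_step \<theta> n c \<in> D01"
proof -
  have "(add_step \<theta> n c \<longlongrightarrow> add_step \<theta> n c t) (at_right t)" if t: "t \<in> {0..<1}" for t
  proof -
    have "t < (of_int \<lfloor>2 ^ n * t\<rfloor> + 1) / 2 ^ n"
      by (simp add: pos_less_divide_eq mult.commute)
    then have "\<forall>\<^sub>F s in at_right t. s \<in> {t<..<min 1 ((of_int \<lfloor>2 ^ n * t\<rfloor> + 1) / 2 ^ n)}"
      using t by (intro eventually_at_right_real) auto
    then have "\<forall>\<^sub>F s in at_right t. \<theta> s + step n c t = add_step \<theta> n c s"
    proof eventually_elim
      case (elim s)
      have "2 ^ n * t \<le> 2 ^ n * s" using elim by simp
      then have "of_int \<lfloor>2 ^ n * t\<rfloor> \<le> 2 ^ n * s"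
        using of_int_floor_le order_trans by blast
      moreover have "2 ^ n * s < of_int \<lfloor>2 ^ n * t\<rfloor> + 1"
        using elim by (simp add: pos_less_divide_eq mult.commute)
      ultimately have "\<lfloor>2 ^ n * s\<rfloor> = \<lfloor>2 ^ n * t\<rfloor>"
        by (intro floor_unique)
      then show ?case using elim t by (simp add: add_step_def step_def)
    qed
    moreover have "((\<lambda>s. \<theta> s + step n c t) \<longlongrightarrow> \<theta> t + step n c t) (at_right t)"
      using assms t by (intro tendsto_intros) (auto simp: D01_def)
    ultimately show ?thesis
      using t by (auto simp: add_step_def intro: Lim_transform_eventually)
  qed
  moreover have "\<exists>l. (add_step \<theta> n c \<longlongrightarrow> l) (at_left t)" if t: "t \<in> {0<..1}" for t
  proof -
    have "\<exists>l. (\<theta> \<longlongrightarrow> l) (at_left t)"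
      using assms t by (auto simp: D01_def)
    then obtain l where l: "(\<theta> \<longlongrightarrow> l) (at_left t)" ..
    \<comment> \<open>From the left the relevant index is the ceiling minus one: at a grid point
      \<open>t\<close> this is the preceding interval, elsewhere it equals the floor.\<close>
    have "(of_int \<lceil>2 ^ n * t\<rceil> - 1) / 2 ^ n < t"
      by (simp add: pos_divide_less_eq mult.commute) linarith
    then have "\<forall>\<^sub>F s in at_left t. s \<in> {max 0 ((of_int \<lceil>2 ^ n * t\<rceil> - 1) / 2 ^ n)<..<t}"
      using t by (intro eventually_at_left_real) auto
    then have "\<forall>\<^sub>F s in at_left t. \<theta> s + c (nat (\<lceil>2 ^ n * t\<rceil> - 1)) = add_step \<theta> n c s"
    proof eventually_elim
      case (elim s)
      have "of_int \<lceil>2 ^ n * t\<rceil> - 1 \<le> 2 ^ n * s"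
        using elim by (simp add: pos_divide_less_eq mult.commute)
      moreover have "2 ^ n * s < 2 ^ n * t"
        using elim by simp
      ultimately have "\<lfloor>2 ^ n * s\<rfloor> = \<lceil>2 ^ n * t\<rceil> - 1"
        by (intro floor_unique) (auto intro: less_le_trans[OF _ le_of_int_ceiling])
      then show ?case using elim t by (simp add: add_step_def step_def)
    qed
    moreover have "((\<lambda>s. \<theta> s + c (nat (\<lceil>2 ^ n * t\<rceil> - 1))) \<longlongrightarrow> l + c (nat (\<lceil>2 ^ n * t\<rceil> - 1))) (at_left t)"
      by (intro tendsto_intros l)
    ultimately show ?thesis
      by (blast intro: Lim_transform_eventually)
  qed
  ultimately show ?thesis
    by (auto simp: D01_def add_step_def)
qed

text \<open>On \<open>{a..<b}\<close>, of length \<open>1 / 2 ^ m\<close>, the step function equals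
  \<open>c j\<close>. The index jumps at \<open>b\<close>, which is a null set.\<close>

lemma integral_add_step_increment:
  assumes \<theta>: "\<theta> \<in> D01" and j: "j < 2 ^ m"
  defines "a \<equiv> real j / 2 ^ m" and "b \<equiv> real (Suc j) / 2 ^ m"
  shows "(LINT v:{0..b}|lborel. add_step \<theta> m c v) - (LINT v:{0..a}|lborel. add_step \<theta> m c v)
    = (LINT v:{0..b}|lborel. \<theta> v) - (LINT v:{0..a}|lborel. \<theta> v) + c j / 2 ^ m"
proof -
  have ab: "0 \<le> a" "a \<le> b" "b - a = 1 / 2 ^ m"
    by (simp_all add: a_def b_def add_divide_distrib divide_right_mono)
  have "b \<in> dyadic_points"
    unfolding dyadic_points_def dyadic_grid_def b_def using j by (intro UN_I[of m] image_eqI[of _ _ "Suc j"]) auto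
  then have b: "b \<le> 1" using dyadic_points_subset by auto
  have diff: "(LINT v:{0..b}|lborel. \<eta> v) - (LINT v:{0..a}|lborel. \<eta> v) = integral {a..b} \<eta>"
    if "\<eta> \<in> D01" for \<eta>
    using D01_integral[OF that, of b] D01_integral[OF that, of a] ab b
      Henstock_Kurzweil_Integration.integral_combine[of 0 a b \<eta>] by simp
  have "integral {a..b} (add_step \<theta> m c) = integral {a..b} (\<lambda>v. \<theta> v + c j)"
  proof (rule integral_spike[of "{b}"])
    fix v assume v: "v \<in> {a..b} - {b}"
    then have "a \<le> v" "v < b" by auto
    then have "real j \<le> 2 ^ m * v" "2 ^ m * v < real j + 1"
      by (simp_all add: a_def b_def pos_divide_le_eq pos_less_divide_eq mult.commute add.commute)
    then have "\<lfloor>2 ^ m * v\<rfloor> = int j" by (intro floor_unique) auto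
    then show "\<theta> v + c j = add_step \<theta> m c v"
      using v ab b by (simp add: add_step_def step_def)
  qed simp
  also have "\<dots> = integral {a..b} \<theta> + integral {a..b} (\<lambda>v. c j)"
    using integrable_subinterval_real[OF D01_integral(1)[OF \<theta>, of 1], of a b] ab b
    by (intro Henstock_Kurzweil_Integration.integral_add) auto
  also have "integral {a..b} (\<lambda>v. c j) = c j / 2 ^ m"
    using ab by simp
  finally show ?thesis
    by (simp only: diff[OF \<theta>] diff[OF add_step_in_D01[OF \<theta>]])
qed

lemma add_step_refine: "add_step \<theta> n c = add_step \<theta> (n + d) (\<lambda>j. c (j div 2 ^ d))"
  using step_refine[of _ n c d] by (auto simp: add_step_def)

section \<open>Completeness\<close>

lemma prod_indicator_eq_of_bool:
  fixes B :: "'i \<Rightarrow> 'b set"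
  assumes "finite I"
  shows "(\<Prod>i\<in>I. indicator (B i) (f i)) = (of_bool (\<forall>i\<in>I. f i \<in> B i) :: 'c::comm_semiring_1)"
  using assms by (induction I rule: finite_induct) (auto simp: indicator_def)

text \<open>Completing the square turns the tilted centred Gaussian density into a translated one.\<close>

lemma nn_integral_gaussian_tilt:
  fixes D :: "'a \<Rightarrow> real"
  assumes D: "distributed M lborel D (normal_density 0 \<sigma>)" and "0 < \<sigma>" and [measurable]: "A \<in> sets borel"
  shows "(\<integral>\<^sup>+\<omega>. ennreal (exp (a * D \<omega> - a\<^sup>2 * \<sigma>\<^sup>2 / 2)) * indicator A (D \<omega>) \<partial>M)
    = (\<integral>\<^sup>+\<omega>. indicator A (D \<omega> + a * \<sigma>\<^sup>2) \<partial>M)"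
proof -
  have *: "(\<integral>\<^sup>+\<omega>. g (D \<omega>) \<partial>M) = (\<integral>\<^sup>+x. normal_density 0 \<sigma> x * g x \<partial>lborel)"
    if "g \<in> borel_measurable borel" for g :: "real \<Rightarrow> ennreal"
    using distributed_nn_integral[OF D, of g] that by simp
  have square: "normal_density 0 \<sigma> (a * \<sigma>\<^sup>2 + x) * exp (a * (a * \<sigma>\<^sup>2 + x) - a\<^sup>2 * \<sigma>\<^sup>2 / 2) = normal_density 0 \<sigma> x" for x
  proof -
    have "- (a * \<sigma>\<^sup>2 + x)\<^sup>2 / (2 * \<sigma>\<^sup>2) + (a * (a * \<sigma>\<^sup>2 + x) - a\<^sup>2 * \<sigma>\<^sup>2 / 2) = - x\<^sup>2 / (2 * \<sigma>\<^sup>2)"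
      using \<open>0 < \<sigma>\<close> by (simp add: field_simps power2_eq_square)
    then show ?thesis
      by (simp add: normal_density_def flip: exp_add)
  qed
  have "(\<integral>\<^sup>+\<omega>. ennreal (exp (a * D \<omega> - a\<^sup>2 * \<sigma>\<^sup>2 / 2)) * indicator A (D \<omega>) \<partial>M)
      = (\<integral>\<^sup>+x. normal_density 0 \<sigma> x * (ennreal (exp (a * x - a\<^sup>2 * \<sigma>\<^sup>2 / 2)) * indicator A x) \<partial>lborel)"
    by (intro *) measurable
  also have "\<dots> = (\<integral>\<^sup>+x. ennreal (normal_density 0 \<sigma> x * exp (a * x - a\<^sup>2 * \<sigma>\<^sup>2 / 2)) * indicator A x \<partial>lborel)"
    by (simp add: ennreal_mult mult.assoc)
  \<comment> \<open>Lebesgue measure is translated by \<open>a * \<sigma>\<^sup>2\<close>, the mean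
    of the tilted Gaussian.\<close>
  also have "\<dots> = (\<integral>\<^sup>+x. ennreal (normal_density 0 \<sigma> x) * indicator A (a * \<sigma>\<^sup>2 + x) \<partial>lborel)"
    by (subst nn_integral_real_affine[where c = 1 and t = "a * \<sigma>\<^sup>2"]) (simp_all add: square)
  also have "\<dots> = (\<integral>\<^sup>+\<omega>. indicator A (a * \<sigma>\<^sup>2 + D \<omega>) \<partial>M)"
    by (intro *[symmetric]) measurable
  finally show ?thesis by (simp add: add.commute)
qed

section \<open>Dyadic Brownian increments and the change of measure\<close>

context standard_brownian_motion
begin

definition dW :: "nat \<Rightarrow> nat \<Rightarrow> 'a \<Rightarrow> real" where
  "dW m j \<omega> = W (real (Suc j) / 2 ^ m) \<omega> - W (real j / 2 ^ m) \<omega>"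

text \<open>For the step function with values \<open>c j\<close>, the exponent is its stochastic
  integral against \<open>W\<close> minus half the integral of its square.\<close>

definition girsanov_density :: "nat \<Rightarrow> (nat \<Rightarrow> real) \<Rightarrow> 'a \<Rightarrow> real" where
  "girsanov_density m c \<omega> = exp (\<Sum>j<2 ^ m. c j * dW m j \<omega> - (c j)\<^sup>2 * (1 / 2 ^ m) / 2)"

lemma dyadic_in_unit_interval: "j \<le> 2 ^ m \<Longrightarrow> real j / 2 ^ m \<in> {0..1}"
  using dyadic_points_subset by (auto simp: dyadic_points_def dyadic_grid_def)

lemma distributed_dW:
  assumes "j < 2 ^ m"
  shows "distributed M lborel (dW m j) (normal_density 0 (sqrt (1 / 2 ^ m)))"
proof -
  have "real (Suc j) / 2 ^ m \<in> {0..1}"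
    using assms by (intro dyadic_in_unit_interval) auto
  then show ?thesis
    using gaussian_increments[of "real j / 2 ^ m" "real (Suc j) / 2 ^ m"]
    by (simp add: dW_def[abs_def] divide_strict_right_mono flip: diff_divide_distrib)
qed

lemma measurable_dW:
  assumes "j < 2 ^ m"
  shows "dW m j \<in> borel_measurable M"
  using distributed_measurable[OF distributed_dW[OF assms]] by simp

lemma indep_vars_dW: "indep_vars (\<lambda>_. borel) (dW m) {..<2 ^ m}"
proof -
  have "strict_mono_on {..2 ^ m} (\<lambda>i::nat. real i / 2 ^ m)"
    by (intro strict_mono_onI) (simp add: divide_strict_right_mono)
  moreover have "(\<lambda>i::nat. real i / 2 ^ m) ` {..2 ^ m} \<subseteq> {0..1}"
    using dyadic_in_unit_interval[of _ m] by blast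
  ultimately show ?thesis
    using independent_increments[of "2 ^ m" "\<lambda>i. real i / 2 ^ m"] by (simp add: dW_def[abs_def])
qed

lemma measurable_girsanov_density: "girsanov_density m c \<in> borel_measurable M"
proof -
  have [measurable]: "j < 2 ^ m \<Longrightarrow> dW m j \<in> borel_measurable M" for j
    by (rule measurable_dW)
  show ?thesis
    unfolding girsanov_density_def[abs_def] by measurable
qed

text \<open>Both integrals in the exponent are independent of the grid on which the step function is
  written: each coarse increment is the telescoping sum of \<open>2 ^ d\<close> fine ones, and
  interval lengths add up.\<close>

lemma girsanov_density_refine:
  "girsanov_density n c = girsanov_density (n + d) (\<lambda>j. c (j div 2 ^ d))"
proof
  fix \<omega>
  let ?f = "\<lambda>i. c (i div 2 ^ d) * dW (n + d) i \<omega> - (c (i div 2 ^ d))\<^sup>2 * (1 / 2 ^ (n + d)) / 2"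
  have "sum ?f {j * 2 ^ d..<j * 2 ^ d + 2 ^ d} = c j * dW n j \<omega> - (c j)\<^sup>2 * (1 / 2 ^ n) / 2" for j
  proof -
    have "sum ?f {j * 2 ^ d..<j * 2 ^ d + 2 ^ d}
        = (\<Sum>i=j * 2 ^ d..<j * 2 ^ d + 2 ^ d. c j * dW (n + d) i \<omega> - (c j)\<^sup>2 * (1 / 2 ^ (n + d)) / 2)"
    proof (intro sum.cong refl)
      fix i :: nat assume "i \<in> {j * 2 ^ d..<j * 2 ^ d + 2 ^ d}"
      then have "i div 2 ^ d = j"
        by (intro div_nat_eqI) (auto simp: algebra_simps)
      then show "?f i = c j * dW (n + d) i \<omega> - (c j)\<^sup>2 * (1 / 2 ^ (n + d)) / 2" by simp
    qed
    also have "\<dots> = c j * (\<Sum>i=j * 2 ^ d..<j * 2 ^ d + 2 ^ d. dW (n + d) i \<omega>) - (c j)\<^sup>2 * (1 / 2 ^ n) / 2"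
      by (simp add: sum_subtractf sum_distrib_left power_add)
    also have "(\<Sum>i=j * 2 ^ d..<j * 2 ^ d + 2 ^ d. dW (n + d) i \<omega>)
        = W (real (j * 2 ^ d + 2 ^ d) / 2 ^ (n + d)) \<omega> - W (real (j * 2 ^ d) / 2 ^ (n + d)) \<omega>"
      unfolding dW_def by (rule sum_Suc_diff') simp
    also have "real (j * 2 ^ d + 2 ^ d) = real (Suc j) * 2 ^ d"
      by (simp add: algebra_simps)
    also have "real (Suc j) * 2 ^ d / 2 ^ (n + d) = real (Suc j) / 2 ^ n"
      by (simp only: power_add mult_divide_mult_cancel_right power_eq_0_iff) simp
    also have "real (j * 2 ^ d) / 2 ^ (n + d) = real j / 2 ^ n"
      by (simp add: power_add)
    finally show ?thesis by (simp add: dW_def)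
  qed
  then have "(\<Sum>j<2 ^ n. c j * dW n j \<omega> - (c j)\<^sup>2 * (1 / 2 ^ n) / 2)
      = (\<Sum>j<2 ^ n. sum ?f {j * 2 ^ d..<j * 2 ^ d + 2 ^ d})"
    by simp
  also have "\<dots> = sum ?f {..<2 ^ (n + d)}"
    by (simp only: sum.nat_group power_add)
  finally show "girsanov_density n c \<omega> = girsanov_density (n + d) (\<lambda>j. c (j div 2 ^ d)) \<omega>"
    by (simp only: girsanov_density_def)
qed

text \<open>Independence of the increments factors both sides, and the one-dimensional Gaussian tilt
  with variance \<open>1 / 2 ^ m\<close> matches the factors.\<close>

lemma nn_integral_girsanov_density:
  assumes A: "\<And>j. A j \<in> sets borel"
  shows "(\<integral>\<^sup>+\<omega>. ennreal (girsanov_density m c \<omega>) * of_bool (\<forall>j<2 ^ m. dW m j \<omega> \<in> A j) \<partial>M)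
    = (\<integral>\<^sup>+\<omega>. of_bool (\<forall>j<2 ^ m. dW m j \<omega> + c j / 2 ^ m \<in> A j) \<partial>M)"
proof -
  have [measurable]: "A j \<in> sets borel" for j by (rule A)
  let ?I = "{..<(2::nat) ^ m}"
  let ?g = "\<lambda>j x. ennreal (exp (c j * x - (c j)\<^sup>2 * (1 / 2 ^ m) / 2)) * indicator (A j) x"
  let ?h = "\<lambda>j x. indicator (A j) (x + c j / 2 ^ m) :: ennreal"
  have "(\<integral>\<^sup>+\<omega>. ennreal (girsanov_density m c \<omega>) * of_bool (\<forall>j<2 ^ m. dW m j \<omega> \<in> A j) \<partial>M)
      = (\<integral>\<^sup>+\<omega>. (\<Prod>j\<in>?I. ?g j (dW m j \<omega>)) \<partial>M)"
    by (simp add: girsanov_density_def exp_sum prod.distrib prod_ennreal prod_indicator_eq_of_bool Ball_def)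
  also have "\<dots> = (\<Prod>j\<in>?I. \<integral>\<^sup>+\<omega>. ?g j (dW m j \<omega>) \<partial>M)"
    by (intro indep_vars_nn_integral indep_vars_compose2[OF indep_vars_dW, where Y = ?g]) auto
  also have "\<dots> = (\<Prod>j\<in>?I. \<integral>\<^sup>+\<omega>. ?h j (dW m j \<omega>) \<partial>M)"
  proof (intro prod.cong refl)
    fix j assume "j \<in> ?I"
    then show "(\<integral>\<^sup>+\<omega>. ?g j (dW m j \<omega>) \<partial>M) = (\<integral>\<^sup>+\<omega>. ?h j (dW m j \<omega>) \<partial>M)"
      using nn_integral_gaussian_tilt[OF distributed_dW, of j m "A j" "c j"] by simp
  qed
  also have "\<dots> = (\<integral>\<^sup>+\<omega>. (\<Prod>j\<in>?I. ?h j (dW m j \<omega>)) \<partial>M)"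
    by (intro indep_vars_nn_integral[symmetric] indep_vars_compose2[OF indep_vars_dW, where Y = ?h]) auto
  finally show ?thesis
    by (simp add: prod_indicator_eq_of_bool Ball_def)
qed

lemma integrable_girsanov_density: "integrable M (girsanov_density m c)"
proof (rule integrableI_bounded)
  \<comment> \<open>With no constraint on the increments, the tilt identity says that the density
    has total mass 1.\<close>
  have "(\<integral>\<^sup>+\<omega>. ennreal (girsanov_density m c \<omega>) \<partial>M) = emeasure M (space M)"
    using nn_integral_girsanov_density[of "\<lambda>_. UNIV" m c] by simp
  then show "(\<integral>\<^sup>+\<omega>. ennreal (norm (girsanov_density m c \<omega>)) \<partial>M) < \<infinity>"
    by (simp add: girsanov_density_def emeasure_space_1)
qed (rule measurable_girsanov_density)

section \<open>Laws of drifted paths, tested on increments\<close>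

lemma measurable_drift_path:
  assumes "\<theta> \<in> D01"
  shows "drift_path W \<theta> \<in> measurable M C01"
proof (rule measurable_C01I)
  fix \<omega> assume "\<omega> \<in> space M"
  then show "drift_path W \<theta> \<omega> \<in> space C01"
    by (intro drift_path_in_C01 assms continuous_paths)
next
  fix t :: real assume t: "t \<in> {0..1}"
  then have [measurable]: "W t \<in> borel_measurable M" by (rule random_variable)
  show "(\<lambda>\<omega>. drift_path W \<theta> \<omega> t) \<in> borel_measurable M"
    using t unfolding drift_path_def by simp
qed

definition drift_increment :: "(real \<Rightarrow> real) \<Rightarrow> nat \<Rightarrow> nat \<Rightarrow> real" where
  "drift_increment \<theta> m j =
    (LINT v:{0..real (Suc j) / 2 ^ m}|lborel. \<theta> v) - (LINT v:{0..real j / 2 ^ m}|lborel. \<theta> v)"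

lemma increments_drift_path_iff:
  assumes "\<theta> \<in> D01" "\<omega> \<in> space M"
  shows "(\<forall>j\<le>2 ^ m. increment m (drift_path W \<theta> \<omega>) j \<in> A j) \<longleftrightarrow>
    0 \<in> A 0 \<and> (\<forall>j<2 ^ m. dW m j \<omega> \<in> {x. x + drift_increment \<theta> m j \<in> A (Suc j)})"
proof -
  have zero: "increment m (drift_path W \<theta> \<omega>) 0 = 0"
    using D01_integral[OF assms(1), of 0] start[OF assms(2)] by (simp add: drift_path_def)
  have inc: "increment m (drift_path W \<theta> \<omega>) (Suc j) = dW m j \<omega> + drift_increment \<theta> m j" if "j < 2 ^ m" for j
    using dyadic_in_unit_interval[of j m] dyadic_in_unit_interval[of "Suc j" m] that
    by (simp add: drift_path_def dW_def drift_increment_def)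
  have "(\<forall>j\<le>2 ^ m. increment m (drift_path W \<theta> \<omega>) j \<in> A j) \<longleftrightarrow>
      increment m (drift_path W \<theta> \<omega>) 0 \<in> A 0 \<and> (\<forall>j<2 ^ m. increment m (drift_path W \<theta> \<omega>) (Suc j) \<in> A (Suc j))"
    by (metis Suc_le_eq le0 not0_implies_Suc)
  then show ?thesis using zero inc by auto
qed

text \<open>All paths start at 0, so slot 0 contributes only the constant factor. The weight
  \<open>f\<close> is general so as to cover the constant 1, the Girsanov density and the positive
  parts of a random variable.\<close>

lemma emeasure_density_drift_path:
  assumes \<theta>: "\<theta> \<in> D01" and [measurable]: "f \<in> borel_measurable M" and A: "range A \<subseteq> sets borel"
  shows "emeasure (distr (density M f) C01 (drift_path W \<theta>)) {x \<in> space C01. \<forall>j\<le>2 ^ m. increment m x j \<in> A j}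
    = of_bool (0 \<in> A 0) * (\<integral>\<^sup>+\<omega>. f \<omega> * of_bool (\<forall>j<2 ^ m. dW m j \<omega> \<in> {x. x + drift_increment \<theta> m j \<in> A (Suc j)}) \<partial>M)"
proof -
  have [measurable]: "A j \<in> sets borel" for j using A by auto
  note [measurable] = measurable_drift_path[OF \<theta>]
  have inc [measurable]: "(\<lambda>x. increment m x j) \<in> borel_measurable C01" if "j \<le> 2 ^ m" for j
    by (rule measurable_increment[OF that])
  let ?R = "{x \<in> space C01. \<forall>j\<le>2 ^ m. increment m x j \<in> A j}"
  have R [measurable]: "?R \<in> sets C01"
  proof -
    have "?R = {x \<in> space C01. \<forall>j\<in>{..2 ^ m}. increment m x j \<in> A j}" by auto
    also have "\<dots> \<in> sets C01"
    proof (intro sets.sets_Collect_finite_All')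
      fix j :: nat assume "j \<in> {..2 ^ m}"
      then have [measurable]: "(\<lambda>x. increment m x j) \<in> borel_measurable C01" using inc by simp
      show "{x \<in> space C01. increment m x j \<in> A j} \<in> sets C01" by measurable
    qed auto
    finally show ?thesis .
  qed
  have "emeasure (distr (density M f) C01 (drift_path W \<theta>)) ?R
      = (\<integral>\<^sup>+\<omega>. f \<omega> * indicator (drift_path W \<theta> -` ?R \<inter> space M) \<omega> \<partial>M)"
    by (subst emeasure_distr) (simp_all add: emeasure_density measurable_sets[OF measurable_drift_path[OF \<theta>] R])
  also have "\<dots> = (\<integral>\<^sup>+\<omega>. of_bool (0 \<in> A 0) *
      (f \<omega> * of_bool (\<forall>j<2 ^ m. dW m j \<omega> \<in> {x. x + drift_increment \<theta> m j \<in> A (Suc j)})) \<partial>M)"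
  proof (intro nn_integral_cong)
    fix \<omega> assume \<omega>: "\<omega> \<in> space M"
    then have "drift_path W \<theta> \<omega> \<in> space C01"
      using measurable_space[OF measurable_drift_path[OF \<theta>]] by blast
    then show "f \<omega> * indicator (drift_path W \<theta> -` ?R \<inter> space M) \<omega> = of_bool (0 \<in> A 0) *
      (f \<omega> * of_bool (\<forall>j<2 ^ m. dW m j \<omega> \<in> {x. x + drift_increment \<theta> m j \<in> A (Suc j)}))"
      using \<omega> increments_drift_path_iff[OF \<theta> \<omega>, of m A] by (auto simp: indicator_def)
  qed
  also have "\<dots> = of_bool (0 \<in> A 0) * (\<integral>\<^sup>+\<omega>. f \<omega> * of_bool (\<forall>j<2 ^ m. dW m j \<omega> \<in> {x. x + drift_increment \<theta> m j \<in> A (Suc j)}) \<partial>M)"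
    by (cases "0 \<in> A 0") simp_all
  finally show ?thesis .
qed

text \<open>Girsanov's theorem for step perturbations, relative to \<open>\<theta>\<close>. On a
  grid of level \<open>m \<ge> n\<close>, the step function moves each drift increment by
  \<open>c (j div 2 ^ d) / 2 ^ m\<close>, where \<open>m = n + d\<close>; the density translates the
  Brownian increments by the same amounts.\<close>

lemma drift_law_add_step:
  assumes \<theta>: "\<theta> \<in> D01"
  shows "drift_law M W (add_step \<theta> n c) = distr (density M (girsanov_density n c)) C01 (drift_path W \<theta>)"
proof (rule measure_C01_eqI_increments[where n = n])
  note [measurable] = measurable_drift_path[OF \<theta>] measurable_drift_path[OF add_step_in_D01[OF \<theta>]]
  interpret law: prob_space "drift_law M W (add_step \<theta> n c)"
    unfolding drift_law_def by (rule prob_space_distr) measurable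
  show "finite_measure (drift_law M W (add_step \<theta> n c))" by (rule law.finite_measure_axioms)
  fix m and A :: "nat \<Rightarrow> real set" assume "n \<le> m" and A: "range A \<subseteq> sets borel"
  then obtain d where m: "m = n + d" using le_Suc_ex by blast
  let ?c = "\<lambda>j. c (j div 2 ^ d)"
  let ?A = "\<lambda>j. {x. x + drift_increment \<theta> m j \<in> A (Suc j)}"
  have [measurable]: "A j \<in> sets borel" for j using A by auto
  have A': "?A j \<in> sets borel" for j by measurable
  have *: "add_step \<theta> n c = add_step \<theta> m ?c" "girsanov_density n c = girsanov_density m ?c"
    unfolding m by (rule add_step_refine, rule girsanov_density_refine)
  have drift: "drift_increment (add_step \<theta> m ?c) m j = drift_increment \<theta> m j + ?c j / 2 ^ m" if "j < 2 ^ m" for j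
    using integral_add_step_increment[OF \<theta> that, of ?c] by (simp add: drift_increment_def)
  have "emeasure (drift_law M W (add_step \<theta> n c)) {x \<in> space C01. \<forall>j\<le>2 ^ m. increment m x j \<in> A j}
      = of_bool (0 \<in> A 0) * (\<integral>\<^sup>+\<omega>. of_bool (\<forall>j<2 ^ m. dW m j \<omega> \<in> {x. x + drift_increment (add_step \<theta> m ?c) m j \<in> A (Suc j)}) \<partial>M)"
    using emeasure_density_drift_path[OF add_step_in_D01[OF \<theta>, of m ?c] _ A, of "\<lambda>_. 1" m]
    by (simp add: drift_law_def * density_1)
  also have "\<dots> = of_bool (0 \<in> A 0) * (\<integral>\<^sup>+\<omega>. of_bool (\<forall>j<2 ^ m. dW m j \<omega> + ?c j / 2 ^ m \<in> ?A j) \<partial>M)"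
    by (simp add: drift add_ac cong: imp_cong)
  also have "\<dots> = of_bool (0 \<in> A 0) * (\<integral>\<^sup>+\<omega>. ennreal (girsanov_density m ?c \<omega>) * of_bool (\<forall>j<2 ^ m. dW m j \<omega> \<in> ?A j) \<partial>M)"
    using nn_integral_girsanov_density[of ?A m ?c, OF A'] by simp
  also have "\<dots> = emeasure (distr (density M (girsanov_density n c)) C01 (drift_path W \<theta>)) {x \<in> space C01. \<forall>j\<le>2 ^ m. increment m x j \<in> A j}"
    using measurable_girsanov_density[of m ?c] by (subst emeasure_density_drift_path[OF \<theta> _ A]) (simp_all add: *)
  finally show "emeasure (drift_law M W (add_step \<theta> n c)) {x \<in> space C01. \<forall>j\<le>2 ^ m. increment m x j \<in> A j}
    = emeasure (distr (density M (girsanov_density n c)) C01 (drift_path W \<theta>)) {x \<in> space C01. \<forall>j\<le>2 ^ m. increment m x j \<in> A j}" .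
qed (simp_all add: drift_law_def)

text \<open>Seen on \<open>M\<close>, the hypothesis is a vanishing Laplace transform at every
  dyadic level. It makes the positive and negative parts of \<open>Y\<close> induce the same measure
  on path space; as they live on disjoint sets, both vanish.\<close>

lemma AE_zero_if_add_step_means_zero:
  fixes Y :: "(real \<Rightarrow> real) \<Rightarrow> real"
  assumes \<theta>: "\<theta> \<in> D01" and Y [measurable]: "Y \<in> borel_measurable C01"
    and bound: "AE x in drift_law M W \<theta>. \<bar>Y x\<bar> \<le> K"
    and zero: "\<And>n c. (LINT x|drift_law M W (add_step \<theta> n c). Y x) = 0"
  shows "AE x in drift_law M W \<theta>. Y x = 0"
proof -
  note X [measurable] = measurable_drift_path[OF \<theta>]
  define V where "V \<omega> = Y (drift_path W \<theta> \<omega>)" for \<omega>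
  have V [measurable]: "V \<in> borel_measurable M"
    unfolding V_def[abs_def] by measurable
  have "{x \<in> space C01. \<bar>Y x\<bar> \<le> K} \<in> sets C01" "{x \<in> space C01. Y x = 0} \<in> sets C01"
    by measurable
  note AE_iff = this[THEN AE_distr_iff[OF X], folded drift_law_def]
  have V_bound: "AE \<omega> in M. \<bar>V \<omega>\<bar> \<le> K"
    using bound by (simp add: AE_iff V_def)
  have int_V: "integrable M V"
    by (rule integrable_const_bound[where B = K]) (use V_bound in auto)
  \<comment> \<open>A pure exponential differs from the Girsanov density by a deterministic factor,
    so integrability and zero means carry over from one to the other.\<close>
  have exp_eq: "exp (\<Sum>j<2 ^ m. c j * dW m j \<omega>) = girsanov_density m c \<omega> * exp (\<Sum>j<2 ^ m. (c j)\<^sup>2 * (1 / 2 ^ m) / 2)" for m c \<omega>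
    by (simp add: girsanov_density_def sum_subtractf flip: exp_add)
  have int: "integrable M (\<lambda>\<omega>. V \<omega> * exp (\<Sum>j<2 ^ m. c j * dW m j \<omega>))" for m c
  proof -
    note [measurable] = measurable_girsanov_density[of m c]
    have "integrable M (\<lambda>\<omega>. V \<omega> * girsanov_density m c \<omega>)"
    proof (rule Bochner_Integration.integrable_bound)
      show "integrable M (\<lambda>\<omega>. K * girsanov_density m c \<omega>)"
        by (intro integrable_mult_right integrable_girsanov_density)
      show "AE \<omega> in M. norm (V \<omega> * girsanov_density m c \<omega>) \<le> norm (K * girsanov_density m c \<omega>)"
        using V_bound by eventually_elim (auto simp: abs_mult intro!: mult_right_mono)
    qed measurable
    then have "integrable M (\<lambda>\<omega>. (V \<omega> * girsanov_density m c \<omega>) * exp (\<Sum>j<2 ^ m. (c j)\<^sup>2 * (1 / 2 ^ m) / 2))"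
      by (rule integrable_mult_left)
    then show ?thesis by (simp only: exp_eq mult.assoc)
  qed
  have zero': "(LINT \<omega>|M. V \<omega> * exp (\<Sum>j<2 ^ m. c j * dW m j \<omega>)) = 0" for m c
  proof -
    note [measurable] = measurable_girsanov_density[of m c]
    have "0 = (LINT x|distr (density M (girsanov_density m c)) C01 (drift_path W \<theta>). Y x)"
      using zero[of m c] by (simp add: drift_law_add_step[OF \<theta>])
    also have "\<dots> = (LINT \<omega>|M. girsanov_density m c \<omega> *\<^sub>R V \<omega>)"
      unfolding V_def by (subst integral_distr, simp, simp, subst integral_density)
        (auto simp: girsanov_density_def)
    finally have "(LINT \<omega>|M. V \<omega> * girsanov_density m c \<omega>) = 0"
      by (simp add: mult.commute)
    moreover have "(LINT \<omega>|M. V \<omega> * exp (\<Sum>j<2 ^ m. c j * dW m j \<omega>))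
        = (LINT \<omega>|M. (V \<omega> * girsanov_density m c \<omega>) * exp (\<Sum>j<2 ^ m. (c j)\<^sup>2 * (1 / 2 ^ m) / 2))"
      by (simp only: exp_eq mult.assoc)
    ultimately show ?thesis by simp
  qed
  \<comment> \<open>\<open>\<nu> V\<close> and
    \<open>\<nu> (\<lambda>\<omega>. - V \<omega>)\<close> are the positive and negative parts of
    the signed measure with density \<open>Y\<close> with respect to the law under
    \<open>\<theta>\<close>.\<close>
  define \<nu> where "\<nu> U = distr (density M (\<lambda>\<omega>. ennreal (max 0 (U \<omega>)))) C01 (drift_path W \<theta>)" for U :: "'a \<Rightarrow> real"
  have nu_sets: "emeasure (\<nu> U) E = (\<integral>\<^sup>+\<omega>. ennreal (max 0 (U \<omega>)) * indicator E (drift_path W \<theta> \<omega>) \<partial>M)"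
    if [measurable]: "U \<in> borel_measurable M" "E \<in> sets C01" for U E
  proof -
    have "emeasure (\<nu> U) E = (\<integral>\<^sup>+\<omega>. ennreal (max 0 (U \<omega>)) * indicator (drift_path W \<theta> -` E \<inter> space M) \<omega> \<partial>M)"
      unfolding \<nu>_def by (subst emeasure_distr) (simp_all add: emeasure_density measurable_sets[OF X])
    also have "\<dots> = (\<integral>\<^sup>+\<omega>. ennreal (max 0 (U \<omega>)) * indicator E (drift_path W \<theta> \<omega>) \<partial>M)"
      by (intro nn_integral_cong) (simp add: indicator_def)
    finally show ?thesis .
  qed
  \<comment> \<open>On an increment rectangle the masses differ by the integral of \<open>V\<close>
    times a product of indicators (or both are 0), and that integral is zero by Laplace
    uniqueness.\<close>
  have nu_eq: "\<nu> V = \<nu> (\<lambda>\<omega>. - V \<omega>)"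
  proof (rule measure_C01_eqI_increments[where n = 0])
    show "finite_measure (\<nu> V)"
    proof (rule finite_measureI)
      have "emeasure (\<nu> V) (space C01) = (\<integral>\<^sup>+\<omega>. ennreal (max 0 (V \<omega>)) * indicator (space C01) (drift_path W \<theta> \<omega>) \<partial>M)"
        by (rule nu_sets) auto
      also have "\<dots> \<le> (\<integral>\<^sup>+\<omega>. ennreal (norm (V \<omega>)) \<partial>M)"
        by (intro nn_integral_mono) (auto simp: indicator_def intro!: ennreal_leI)
      also have "\<dots> < \<infinity>"
        using int_V by (simp add: integrable_iff_bounded)
      finally show "emeasure (\<nu> V) (space (\<nu> V)) \<noteq> \<infinity>" by (simp add: \<nu>_def)
    qed
    fix m and A :: "nat \<Rightarrow> real set" assume A: "range A \<subseteq> sets borel"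
    let ?A = "\<lambda>j. {x. x + drift_increment \<theta> m j \<in> A (Suc j)}"
    have [measurable]: "A j \<in> sets borel" for j using A by auto
    have A': "?A j \<in> sets borel" for j by measurable
    let ?p = "\<lambda>\<omega>. \<Prod>j<2 ^ m. indicator (?A j) (dW m j \<omega>) :: real"
    have p [measurable]: "?p \<in> borel_measurable M"
    proof (intro borel_measurable_prod)
      fix j :: nat assume "j \<in> {..<2 ^ m}"
      then have [measurable]: "dW m j \<in> borel_measurable M" "?A j \<in> sets borel"
        using measurable_dW A' by auto
      show "(\<lambda>\<omega>. indicator (?A j) (dW m j \<omega>) :: real) \<in> borel_measurable M" by measurable
    qed
    have p_bool: "?p \<omega> = of_bool (\<forall>j<2 ^ m. dW m j \<omega> \<in> ?A j)" for \<omega>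
      by (simp add: prod_indicator_eq_of_bool Ball_def)
    have int_p: "integrable M (\<lambda>\<omega>. max 0 (U \<omega>) * ?p \<omega>)" if "integrable M U" for U
    proof (rule Bochner_Integration.integrable_bound[OF that])
      note [measurable] = borel_measurable_integrable[OF that]
      show "(\<lambda>\<omega>. max 0 (U \<omega>) * ?p \<omega>) \<in> borel_measurable M" by measurable
      show "AE \<omega> in M. norm (max 0 (U \<omega>) * ?p \<omega>) \<le> norm (U \<omega>)"
        unfolding p_bool by (auto simp: max_def)
    qed
    have rect: "emeasure (\<nu> U) {x \<in> space C01. \<forall>j\<le>2 ^ m. increment m x j \<in> A j}
        = of_bool (0 \<in> A 0) * ennreal (LINT \<omega>|M. max 0 (U \<omega>) * ?p \<omega>)" if "integrable M U" for U
    proof -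
      note [measurable] = borel_measurable_integrable[OF that]
      have "(\<integral>\<^sup>+\<omega>. ennreal (max 0 (U \<omega>)) * of_bool (\<forall>j<2 ^ m. dW m j \<omega> \<in> ?A j) \<partial>M)
          = (\<integral>\<^sup>+\<omega>. ennreal (max 0 (U \<omega>) * ?p \<omega>) \<partial>M)"
        unfolding p_bool by (intro nn_integral_cong) simp
      also have "\<dots> = ennreal (LINT \<omega>|M. max 0 (U \<omega>) * ?p \<omega>)"
        by (intro nn_integral_eq_integral int_p that) (auto simp: p_bool)
      finally show ?thesis
        unfolding \<nu>_def by (subst emeasure_density_drift_path[OF \<theta> _ A]) simp_all
    qed
    have "(LINT \<omega>|M. V \<omega> * ?p \<omega>) = 0"
      by (intro laplace_zero_imp_integral_prod_indicator_zero int zero' measurable_dW A') auto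
    also have "(LINT \<omega>|M. V \<omega> * ?p \<omega>) = (LINT \<omega>|M. max 0 (V \<omega>) * ?p \<omega> - max 0 (- V \<omega>) * ?p \<omega>)"
      by (intro Bochner_Integration.integral_cong refl) (simp add: max_def flip: left_diff_distrib)
    also have "\<dots> = (LINT \<omega>|M. max 0 (V \<omega>) * ?p \<omega>) - (LINT \<omega>|M. max 0 (- V \<omega>) * ?p \<omega>)"
      by (intro Bochner_Integration.integral_diff int_p int_V Bochner_Integration.integrable_minus)
    finally show "emeasure (\<nu> V) {x \<in> space C01. \<forall>j\<le>2 ^ m. increment m x j \<in> A j}
        = emeasure (\<nu> (\<lambda>\<omega>. - V \<omega>)) {x \<in> space C01. \<forall>j\<le>2 ^ m. increment m x j \<in> A j}"
      using rect[OF int_V] rect[OF Bochner_Integration.integrable_minus[OF int_V]] by simp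
  qed (simp_all add: \<nu>_def)
  \<comment> \<open>\<open>E\<close> singles out the paths with \<open>U\<close> positive:
    \<open>\<nu> U\<close> puts its whole mass there, while the measure of \<open>- U\<close> gives
    it none. Equality forces the positive part to vanish.\<close>
  have nonpos: "AE \<omega> in M. U \<omega> \<le> 0"
    if U [measurable]: "U \<in> borel_measurable M" and eq: "\<nu> U = \<nu> (\<lambda>\<omega>. - U \<omega>)"
      and E [measurable]: "E \<in> sets C01" and UE: "\<And>\<omega>. \<omega> \<in> space M \<Longrightarrow> drift_path W \<theta> \<omega> \<in> E \<longleftrightarrow> 0 < U \<omega>" for U E
  proof -
    have "(\<integral>\<^sup>+\<omega>. ennreal (max 0 (U \<omega>)) \<partial>M)
        = (\<integral>\<^sup>+\<omega>. ennreal (max 0 (U \<omega>)) * indicator E (drift_path W \<theta> \<omega>) \<partial>M)"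
      by (intro nn_integral_cong) (auto simp: indicator_def UE max_def)
    also have "\<dots> = (\<integral>\<^sup>+\<omega>. ennreal (max 0 (- U \<omega>)) * indicator E (drift_path W \<theta> \<omega>) \<partial>M)"
      using nu_sets[of U E] nu_sets[of "\<lambda>\<omega>. - U \<omega>" E] eq by simp
    also have "\<dots> = (\<integral>\<^sup>+\<omega>. 0 \<partial>M)"
      by (intro nn_integral_cong) (auto simp: indicator_def UE max_def)
    finally have "AE \<omega> in M. ennreal (max 0 (U \<omega>)) = 0"
      by (subst nn_integral_0_iff_AE[symmetric]) simp_all
    then show ?thesis by eventually_elim (auto simp: max_def split: if_splits)
  qed
  have sp: "\<omega> \<in> space M \<Longrightarrow> drift_path W \<theta> \<omega> \<in> space C01" for \<omega>
    using measurable_space[OF X] .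
  have "AE \<omega> in M. V \<omega> \<le> 0"
    by (rule nonpos[of V "{x \<in> space C01. 0 < Y x}"])
       (use nu_eq sp in \<open>auto simp: V_def[abs_def]\<close>)
  moreover have "AE \<omega> in M. - V \<omega> \<le> 0"
    by (rule nonpos[of "\<lambda>\<omega>. - V \<omega>" "{x \<in> space C01. Y x < 0}"])
       (use nu_eq sp in \<open>auto simp: V_def[abs_def]\<close>)
  ultimately have "AE \<omega> in M. V \<omega> = 0" by eventually_elim auto
  then show ?thesis
    by (simp add: AE_iff V_def)
qed

end

theorem mainTheorem3:
  fixes M :: "'a measure" and W :: "real \<Rightarrow> 'a \<Rightarrow> real"
  assumes "standard_brownian_motion M W"
  shows "boundedly_complete C01 D01 (drift_law M W)"
proof -
  interpret standard_brownian_motion M W by (rule assms)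
  show ?thesis
    unfolding boundedly_complete_def
  proof (intro ballI impI)
    fix Y \<theta>
    assume Y [measurable]: "Y \<in> borel_measurable C01"
      and bounded: "essentially_bounded C01 D01 (drift_law M W) Y"
      and zero: "\<forall>\<theta>\<in>D01. (LINT x|drift_law M W \<theta>. Y x) = 0"
      and \<theta>: "\<theta> \<in> D01"
    note [measurable] = measurable_drift_path[OF \<theta>]
    obtain K where K: "measure (drift_law M W \<theta>) {x \<in> space C01. \<bar>Y x\<bar> \<le> K} = 1"
      using bounded \<theta> by (auto simp: essentially_bounded_def)
    interpret law: prob_space "drift_law M W \<theta>"
      unfolding drift_law_def by (rule prob_space_distr) measurable
    have "{x \<in> space C01. \<bar>Y x\<bar> \<le> K} \<in> sets C01" by measurable
    then have "AE x in drift_law M W \<theta>. \<bar>Y x\<bar> \<le> K"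
      using K law.prob_Collect_eq_1[of "\<lambda>x. \<bar>Y x\<bar> \<le> K"] by (simp add: drift_law_def)
    \<comment> \<open>The perturbed drifts remain in \<open>D01\<close>, so the mean-zero hypothesis
      covers them.\<close>
    then show "AE x in drift_law M W \<theta>. Y x = 0"
      by (rule AE_zero_if_add_step_means_zero[OF \<theta> Y]) (use zero add_step_in_D01[OF \<theta>] in blast)
  qed
qed

end
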